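(* There is a universal constant $C>0$ such that the following holds for all integers $d_1,d_2\ge1$, $n\ge4$ and all $\alpha\in(0,1)$, $\beta\in(0,1-\alpha)$. Let $\mathcal{P}^{(d_1,d_2)}_{\rm Multi}$ be the set of probability distributions $p_{YZ}$ on $\{1,\dots,d_1\}\times\{1,\dots,d_2\}$, with marginals $p_Y,p_Z$ and product of marginals $p_Yp_Z$. Let $\mathcal{P}_0=\{p_{YZ}\in\mathcal{P}^{(d_1,d_2)}_{\rm Multi}:p_{YZ}=p_Yp_Z\}$ and $\mathcal{P}_1=\{p_{YZ}\in\mathcal{P}^{(d_1,d_2)}_{\rm Multi}:\|p_{YZ}-p_Yp_Z\|_2\ge\epsilon_n\}$, where $$\epsilon_n\ \ge\ \frac{C}{\alpha^{1/4}\beta^{1/2}}\,\frac{b_{(2)}^{1/4}}{n^{1/2}},\qquad b_{(2)}:=\max\{\|p_{YZ}\|_2^2,\|p_Yp_Z\|_2^2\}$$ (the separation $\epsilon_n$ is allowed to depend on $p_{YZ}$ through $b_{(2)}$). Then the permutation test based on $U_n$ satisfies $$\sup_{P\in\mathcal{P}_0}\mathbb{P}_P(U_n>c_{1-\alpha,n})\le\alpha\quad\text{and}\quad\sup_{P\in\mathcal{P}_1}\mathbb{P}_P(U_n\le c_{1-\alpha,n})\le\beta .$$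
   Context: Data: $X_i=(Y_i,Z_i)$, $i=1,\dots,n$, i.i.d. from $p_{YZ}$. Let $g_Y(y_1,y_2):=\sum_{k=1}^{d_1}\mathbb{1}(y_1=k)\mathbb{1}(y_2=k)$, $g_Z(z_1,z_2):=\sum_{k=1}^{d_2}\mathbb{1}(z_1=k)\mathbb{1}(z_2=k)$ and, for $x_i=(y_i,z_i)$, $$h_{\rm in}(x_1,x_2,x_3,x_4):=\{g_Y(y_1,y_2)+g_Y(y_3,y_4)-g_Y(y_1,y_3)-g_Y(y_2,y_4)\}\cdot\{g_Z(z_1,z_2)+g_Z(z_3,z_4)-g_Z(z_1,z_3)-g_Z(z_2,z_4)\},$$ $$U_n:=\frac{1}{n(n-1)(n-2)(n-3)}\sum h_{\rm in}(X_{i_1},X_{i_2},X_{i_3},X_{i_4}),$$ sum over all ordered 4-tuples of distinct indices in $\{1,\dots,n\}$. $\|\cdot\|_2$ is the $\ell_2$ norm. Permutation critical value: for a permutation $\pi$ of $\{1,\dots,n\}$, $U_n^\pi$ is $U_n$ computed from $(Y_1,Z_{\pi_1}),\dots,(Y_n,Z_{\pi_n})$, and $c_{1-\alpha,n}:=\inf\{t:\frac1{n!}\sum_\pi\mathbb{1}(U_n^\pi\le t)\ge1-\alpha\}$; the test rejects when $U_n>c_{1-\alpha,n}$. *)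

theory Defs
  imports "HOL-Probability.Probability" "HOL-Combinatorics.Permutations"
begin

definition P_Multi :: "nat \<Rightarrow> nat \<Rightarrow> (nat \<times> nat) pmf set" where
  "P_Multi d1 d2 = {p. set_pmf p \<subseteq> {1..d1} \<times> {1..d2}}"

definition prod_marginals :: "(nat \<times> nat) pmf \<Rightarrow> (nat \<times> nat) pmf" where
  "prod_marginals p = pair_pmf (map_pmf fst p) (map_pmf snd p)"

definition l2norm :: "nat \<Rightarrow> nat \<Rightarrow> (nat \<times> nat \<Rightarrow> real) \<Rightarrow> real" where
  "l2norm d1 d2 f = L2_set f ({1..d1} \<times> {1..d2})"

definition b2 :: "nat \<Rightarrow> nat \<Rightarrow> (nat \<times> nat) pmf \<Rightarrow> real" where
  "b2 d1 d2 p = max ((l2norm d1 d2 (pmf p))\<^sup>2) ((l2norm d1 d2 (pmf (prod_marginals p)))\<^sup>2)"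

definition P_null :: "nat \<Rightarrow> nat \<Rightarrow> (nat \<times> nat) pmf set" where
  "P_null d1 d2 = {p \<in> P_Multi d1 d2. p = prod_marginals p}"

(* The separation may depend on the distribution through b2, so eps is a function of that value. *)
definition P_alt :: "nat \<Rightarrow> nat \<Rightarrow> (real \<Rightarrow> real) \<Rightarrow> (nat \<times> nat) pmf set" where
  "P_alt d1 d2 eps =
     {p \<in> P_Multi d1 d2.
        l2norm d1 d2 (\<lambda>x. pmf p x - pmf (prod_marginals p) x) \<ge> eps (b2 d1 d2 p)}"

definition g_kernel :: "nat \<Rightarrow> nat \<Rightarrow> nat \<Rightarrow> real" where
  "g_kernel d u v = (\<Sum>k=1..d. of_bool (u = k) * of_bool (v = k))"

definition h_in ::
  "nat \<Rightarrow> nat \<Rightarrow> nat \<times> nat \<Rightarrow> nat \<times> nat \<Rightarrow> nat \<times> nat \<Rightarrow> nat \<times> nat \<Rightarrow> real" where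
  "h_in d1 d2 x1 x2 x3 x4 =
     (g_kernel d1 (fst x1) (fst x2) + g_kernel d1 (fst x3) (fst x4)
        - g_kernel d1 (fst x1) (fst x3) - g_kernel d1 (fst x2) (fst x4))
   * (g_kernel d2 (snd x1) (snd x2) + g_kernel d2 (snd x3) (snd x4)
        - g_kernel d2 (snd x1) (snd x3) - g_kernel d2 (snd x2) (snd x4))"

definition U_stat :: "nat \<Rightarrow> nat \<Rightarrow> nat \<Rightarrow> (nat \<Rightarrow> nat \<times> nat) \<Rightarrow> real" where
  "U_stat d1 d2 n x =
     1 / (real n * (real n - 1) * (real n - 2) * (real n - 3)) *
     (\<Sum>(i1, i2, i3, i4) \<in> {(i1, i2, i3, i4). {i1, i2, i3, i4} \<subseteq> {1..n} \<and> distinct [i1, i2, i3, i4]}.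
        h_in d1 d2 (x i1) (x i2) (x i3) (x i4))"

definition permute_sample :: "(nat \<Rightarrow> nat) \<Rightarrow> (nat \<Rightarrow> nat \<times> nat) \<Rightarrow> nat \<Rightarrow> nat \<times> nat" where
  "permute_sample \<pi> x = (\<lambda>i. (fst (x i), snd (x (\<pi> i))))"

definition crit_value :: "nat \<Rightarrow> nat \<Rightarrow> nat \<Rightarrow> real \<Rightarrow> (nat \<Rightarrow> nat \<times> nat) \<Rightarrow> real" where
  "crit_value d1 d2 n \<alpha> x =
     Inf {t. 1 / fact n * (\<Sum>\<pi> | \<pi> permutes {1..n}.
               of_bool (U_stat d1 d2 n (permute_sample \<pi> x) \<le> t)) \<ge> 1 - \<alpha>}"

(* Joint law of the i.i.d. sample x 1, ..., x n; indices outside {1..n} carry the dummy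
   value undefined, which neither U_stat nor crit_value inspects. *)
definition sample_law :: "nat \<Rightarrow> (nat \<times> nat) pmf \<Rightarrow> (nat \<Rightarrow> nat \<times> nat) pmf" where
  "sample_law n p = Pi_pmf {1..n} undefined (\<lambda>_. p)"

end

(* The kernel h_in factors as an inner product of two matrices with mean 2 D, where D = p - pY pZ,
   so U_n has mean 4 |D|^2. Integrating out a pair of indices that does not occur in the other kernel
   shows that two kernels sharing at most one index have covariance at most a multiple of
   sqrt(b_(2)) |D|^2, while any two kernels have covariance at most a multiple of b_(2). Counting
   overlaps bounds the variance of U_n by sqrt(b_(2)) |D|^2 / n + b_(2) / n^2 up to constants.
   In the permutation distribution, the average of a product of two kernels vanishes when they share
   at most one index, because transposing a pair of indices flips the sign of one factor; hence the
   second permutation moment of U_n is at most of order b_(2) / n^2 on average. Chebyshev's inequality,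
   applied to the permutation distribution for the critical value and to the sample for U_n, gives the
   bound on the type II error. The type I bound is the exchangeability of the null distribution. *)
theory Submission
  imports Defs
begin

section \<open>Moments of the kernel\<close>

lemma four_squares: "(r - s - t + u)\<^sup>2 \<le> 4 * (r\<^sup>2 + s\<^sup>2 + t\<^sup>2 + (u::real)\<^sup>2)"
proof -
  \<comment> \<open>Lagrange's identity for (r, s, t, u) and (1, -1, -1, 1): the defect in
    Cauchy-Schwarz is a sum of six squares.\<close>
  have "4 * (r\<^sup>2 + s\<^sup>2 + t\<^sup>2 + u\<^sup>2) - (r - s - t + u)\<^sup>2
     = (r + s)\<^sup>2 + (r + t)\<^sup>2 + (r - u)\<^sup>2 + (s - t)\<^sup>2 + (s + u)\<^sup>2 + (t + u)\<^sup>2"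
    by (simp add: power2_eq_square algebra_simps)
  also have "\<dots> \<ge> 0" by simp
  finally show ?thesis by simp
qed

lemma sum_of_bool_card: "finite A \<Longrightarrow> (\<Sum>x\<in>A. of_bool (P x)) = real (card {x \<in> A. P x})"
  by (simp add: Int_def)

section \<open>Expectations over the i.i.d. sample\<close>

locale multinomial_sample =
  fixes d1 d2 n :: nat and p :: "(nat \<times> nat) pmf"
  assumes supp: "p \<in> P_Multi d1 d2"
begin

definition "G = {1..d1} \<times> {1..d2}"
abbreviation "pY \<equiv> pmf (map_pmf fst p)"
abbreviation "pZ \<equiv> pmf (map_pmf snd p)"
text \<open>The function D is the signal p - pY pZ. For fixed v and w, M is, as a matrix indexed by u,
  the outer product of the differences of the one-hot encodings of the components of v and w.
  Its mean over independent v and w is 2 D, and h_in x1 x2 x3 x4 is the inner product of the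
  matrices belonging to (x1, x4) and (x2, x3).\<close>

definition "D v = pmf p v - pY (fst v) * pZ (snd v)"
definition "E F = measure_pmf.expectation (sample_law n p) (F :: (nat \<Rightarrow> nat \<times> nat) \<Rightarrow> real)"
definition M :: "nat \<times> nat \<Rightarrow> nat \<times> nat \<Rightarrow> nat \<times> nat \<Rightarrow> real" where
  "M u v w = (of_bool (fst v = fst u) - of_bool (fst w = fst u))
           * (of_bool (snd v = snd u) - of_bool (snd w = snd u))"

lemma set_pmf_subset: "set_pmf p \<subseteq> G"
  using supp by (simp add: P_Multi_def G_def)

lemma finite_G [simp]: "finite G"
  by (simp add: G_def)

lemma finite_support: "finite (set_pmf (sample_law n p))"
proof -
  have "finite (set_pmf p)" using set_pmf_subset by (rule finite_subset) (rule finite_G)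
  then show ?thesis
    unfolding sample_law_def by (subst set_Pi_pmf) (auto intro!: finite_PiE_dflt)
qed

lemma support_G: "x \<in> set_pmf (sample_law n p) \<Longrightarrow> i \<in> {1..n} \<Longrightarrow> x i \<in> G"
  using set_pmf_subset unfolding sample_law_def
  by (subst (asm) set_Pi_pmf) (auto simp: PiE_dflt_def)

lemma integrable_E: "integrable (measure_pmf (sample_law n p)) (F :: _ \<Rightarrow> real)"
  using finite_support by (rule integrable_measure_pmf_finite)

lemma E_const [simp]: "E (\<lambda>_. c) = c"
  by (simp add: E_def)

lemma E_add: "E (\<lambda>x. F x + H x) = E F + E H"
  unfolding E_def by (intro Bochner_Integration.integral_add integrable_E)

lemma E_diff: "E (\<lambda>x. F x - H x) = E F - E H"
  unfolding E_def by (intro Bochner_Integration.integral_diff integrable_E)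

lemma E_cmult: "E (\<lambda>x. c * F x) = c * E F"
  unfolding E_def by simp

lemma E_sum: "E (\<lambda>x. \<Sum>i\<in>S. F i x) = (\<Sum>i\<in>S. E (F i))"
  unfolding E_def by (intro Bochner_Integration.integral_sum integrable_E)

lemma E_mono:
  assumes "\<And>x. (\<And>i. i \<in> {1..n} \<Longrightarrow> x i \<in> G) \<Longrightarrow> F x \<le> H x"
  shows "E F \<le> E H"
  unfolding E_def
  by (intro integral_mono_AE integrable_E) (auto simp: AE_measure_pmf_iff intro!: assms dest: support_G)

lemma prob_eq_E: "measure (measure_pmf (sample_law n p)) {x. Q x} = E (\<lambda>x. of_bool (Q x))"
proof -
  have "(\<lambda>x. of_bool (Q x)) = (indicator {x. Q x} :: _ \<Rightarrow> real)"
    by (auto simp: indicator_def)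
  then show ?thesis by (simp add: E_def)
qed

lemma sum_p_eq_expectation: "(\<Sum>v\<in>G. pmf p v * f v) = measure_pmf.expectation p f" for f :: "_ \<Rightarrow> real"
  by (subst integral_measure_pmf[of G]) (use set_pmf_subset in \<open>auto simp: mult.commute\<close>)

lemma sum_p: "(\<Sum>v\<in>G. pmf p v) = 1"
  using sum_p_eq_expectation[of "\<lambda>_. 1"] by simp

text \<open>Coordinates are independent with law \<open>p\<close>, so replacing one by a fresh draw
  preserves the law of the sample. All later integrations over a coordinate go through this
  identity.\<close>

lemma resample:
  assumes "i \<in> {1..n}"
  shows "E F = E (\<lambda>x. \<Sum>v\<in>G. pmf p v * F (x(i := v)))"
proof -
  define A where "A = {1..n} - {i}"
  define q where "q = Pi_pmf A undefined (\<lambda>_. p)"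
  have A: "finite A" "i \<notin> A" "{1..n} = insert i A" using assms by (auto simp: A_def)
  \<comment> \<open>Coordinate \<open>i\<close> is drawn last, so that fixing the others in
    \<open>y\<close> leaves a finite average over \<open>p\<close>.\<close>
  have law: "sample_law n p = bind_pmf q (\<lambda>y. map_pmf (\<lambda>v. y(i := v)) p)"
    unfolding sample_law_def A(3) q_def map_pmf_def
    by (subst Pi_pmf_insert'[OF A(1,2)], subst bind_commute_pmf) simp
  have finp: "finite (set_pmf p)" using set_pmf_subset by (rule finite_subset) (rule finite_G)
  have finq: "finite (set_pmf q)"
    unfolding q_def using finp A(1) by (subst set_Pi_pmf) (auto intro!: finite_PiE_dflt)
  have *: "E F = measure_pmf.expectation q (\<lambda>y. \<Sum>v\<in>G. pmf p v * F (y(i := v)))" for F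
    unfolding E_def law
    by (subst pmf_expectation_bind[OF finq])
       (use finp in \<open>auto simp: sum_p_eq_expectation integral_measure_pmf[OF finq] mult.commute\<close>)
  \<comment> \<open>On the right the redraw overwrites the original draw at \<open>i\<close>, whose
    weights then sum to 1.\<close>
  show ?thesis
    by (subst (1 2) *) (simp add: sum_distrib_right[symmetric] sum_p)
qed

lemma E_coord:
  assumes "i \<in> {1..n}"
  shows "E (\<lambda>x. f (x i)) = (\<Sum>v\<in>G. pmf p v * f v)"
  by (subst resample[OF assms]) simp

lemma E_coord2:
  assumes "i \<in> {1..n}" "j \<in> {1..n}" "i \<noteq> j"
  shows "E (\<lambda>x. f (x i) (x j)) = (\<Sum>v\<in>G. \<Sum>w\<in>G. pmf p v * pmf p w * f v w)"
  using assms(3)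
  by (subst resample[OF assms(2)], subst resample[OF assms(1)])
     (simp add: sum_distrib_left mult.assoc)

lemma sum_p_fst: "(\<Sum>v\<in>G. pmf p v * of_bool (fst v = k)) = pY k"
proof -
  have "(\<lambda>v. of_bool (fst v = k)) = (indicator (fst -` {k}) :: nat \<times> nat \<Rightarrow> real)"
    by (auto simp: indicator_def)
  then show ?thesis by (simp only: sum_p_eq_expectation) (simp add: pmf_map)
qed

lemma sum_p_snd: "(\<Sum>v\<in>G. pmf p v * of_bool (snd v = k)) = pZ k"
proof -
  have "(\<lambda>v. of_bool (snd v = k)) = (indicator (snd -` {k}) :: nat \<times> nat \<Rightarrow> real)"
    by (auto simp: indicator_def)
  then show ?thesis by (simp only: sum_p_eq_expectation) (simp add: pmf_map)
qed

lemma sum_p_both: "(\<Sum>v\<in>G. pmf p v * (of_bool (fst v = fst u) * of_bool (snd v = snd u))) = pmf p u"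
proof -
  have "(\<lambda>v. of_bool (fst v = fst u) * of_bool (snd v = snd u)) = (indicator {u} :: nat \<times> nat \<Rightarrow> real)"
    by (auto simp: indicator_def prod_eq_iff)
  then show ?thesis by (simp only: sum_p_eq_expectation) (simp add: measure_pmf_single)
qed

text \<open>Expanding the product gives four terms. The two that take both components from one point
  average to \<open>pmf p u\<close>, the two mixed ones to the product of the marginals.\<close>

lemma M_mean: "(\<Sum>w\<in>G. pmf p w * (\<Sum>v\<in>G. pmf p v * M u v w)) = 2 * D u"
proof -
  have "(\<Sum>v\<in>G. pmf p v * M u v w) =
     pmf p u - pY (fst u) * of_bool (snd w = snd u) - pZ (snd u) * of_bool (fst w = fst u)
     + of_bool (fst w = fst u) * of_bool (snd w = snd u)" for w
  proof -
    have "(\<Sum>v\<in>G. pmf p v * M u v w) = (\<Sum>v\<in>G.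
        pmf p v * (of_bool (fst v = fst u) * of_bool (snd v = snd u))
        - (pmf p v * of_bool (fst v = fst u)) * of_bool (snd w = snd u)
        - (pmf p v * of_bool (snd v = snd u)) * of_bool (fst w = fst u)
        + pmf p v * (of_bool (fst w = fst u) * of_bool (snd w = snd u)))"
      by (intro sum.cong refl) (simp add: M_def algebra_simps)
    then show ?thesis
      by (simp only: sum.distrib sum_subtractf sum_distrib_right[symmetric]
          sum_p_fst sum_p_snd sum_p_both sum_p mult_1)
  qed
  then have "(\<Sum>w\<in>G. pmf p w * (\<Sum>v\<in>G. pmf p v * M u v w)) = (\<Sum>w\<in>G.
      pmf p w * pmf p u - pY (fst u) * (pmf p w * of_bool (snd w = snd u))
      - pZ (snd u) * (pmf p w * of_bool (fst w = fst u))
      + pmf p w * (of_bool (fst w = fst u) * of_bool (snd w = snd u)))"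
    by (simp only:) (simp add: algebra_simps)
  then show ?thesis
    by (simp only: sum.distrib sum_subtractf sum_distrib_right[symmetric] sum_distrib_left[symmetric]
        sum_p_fst sum_p_snd sum_p_both sum_p mult_1 D_def) (simp add: algebra_simps)
qed

text \<open>\<open>R\<close> does not see the coordinates \<open>i\<close> and \<open>j\<close>, so
  by independence these can be averaged first, and \<open>M_mean\<close> applies inside.\<close>

lemma pair_avg:
  assumes ij: "i \<in> {1..n}" "j \<in> {1..n}" "i \<noteq> j"
    and R: "\<And>u x v. R u (x(i := v)) = R u x" "\<And>u x v. R u (x(j := v)) = R u x"
  shows "E (\<lambda>x. \<Sum>u\<in>G. M u (x i) (x j) * R u x) = E (\<lambda>x. \<Sum>u\<in>G. 2 * D u * R u x)"
proof -
  have "(\<Sum>w\<in>G. pmf p w * (\<Sum>v\<in>G. pmf p v * (\<Sum>u\<in>G. M u v w * R u x))) = (\<Sum>u\<in>G. 2 * D u * R u x)" for x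
  proof -
    have "(\<Sum>w\<in>G. pmf p w * (\<Sum>v\<in>G. pmf p v * (\<Sum>u\<in>G. M u v w * R u x)))
       = (\<Sum>w\<in>G. \<Sum>v\<in>G. \<Sum>u\<in>G. pmf p w * (pmf p v * M u v w) * R u x)"
      by (simp add: sum_distrib_left mult.assoc)
    also have "\<dots> = (\<Sum>u\<in>G. \<Sum>w\<in>G. \<Sum>v\<in>G. pmf p w * (pmf p v * M u v w) * R u x)"
      by (subst sum.swap, subst (2) sum.swap) (subst sum.swap, subst (2) sum.swap, rule refl)
    also have "\<dots> = (\<Sum>u\<in>G. (\<Sum>w\<in>G. pmf p w * (\<Sum>v\<in>G. pmf p v * M u v w)) * R u x)"
      by (simp add: sum_distrib_left sum_distrib_right)
    finally show ?thesis by (simp add: M_mean)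
  qed
  then show ?thesis
    using ij(3)
    by (subst resample[OF ij(1)], subst resample[OF ij(2)]) (simp add: R)
qed

end

section \<open>Kernel covariances by integrating out pairs\<close>

context multinomial_sample
begin

text \<open>K is the kernel h_in in terms of M, and T is its conditional mean given one of its two pairs,
  up to the factor 2; del is the squared L2 norm of the signal.\<close>

definition "b = b2 d1 d2 p"
definition "q u = pY (fst u) * pZ (snd u)"
definition "del = (\<Sum>u\<in>G. (D u)\<^sup>2)"
definition "T i j x = (\<Sum>u\<in>G. M u (x i) (x j) * D u)"
definition "K i j k l x = (\<Sum>u\<in>G. M u (x i) (x j) * M u (x k) (x l))"

lemma sum_p_sq: "(\<Sum>u\<in>G. (pmf p u)\<^sup>2) \<le> b"
  by (simp add: b_def b2_def l2norm_def L2_set_def G_def sum_nonneg le_max_iff_disj)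

lemma sum_q_sq: "(\<Sum>u\<in>G. (q u)\<^sup>2) \<le> b"
proof -
  have "pmf (prod_marginals p) u = q u" for u
    by (cases u) (simp add: prod_marginals_def pmf_pair q_def)
  then show ?thesis
    by (simp add: b_def b2_def l2norm_def L2_set_def G_def sum_nonneg le_max_iff_disj)
qed

text \<open>AM-GM. This mixed sum arises when a match of first components and a match of second
  components share one index.\<close>

lemma sum_p_q: "(\<Sum>u\<in>G. pmf p u * q u) \<le> b"
proof -
  have "(\<Sum>u\<in>G. pmf p u * q u) \<le> (\<Sum>u\<in>G. ((pmf p u)\<^sup>2 + (q u)\<^sup>2) / 2)"
  proof (rule sum_mono)
    fix u show "pmf p u * q u \<le> ((pmf p u)\<^sup>2 + (q u)\<^sup>2) / 2"
      using sum_squares_bound[of "pmf p u" "q u"] by simp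
  qed
  also have "\<dots> = ((\<Sum>u\<in>G. (pmf p u)\<^sup>2) + (\<Sum>u\<in>G. (q u)\<^sup>2)) / 2"
    by (simp add: sum.distrib sum_divide_distrib[symmetric])
  finally show ?thesis using sum_p_sq sum_q_sq by simp
qed

lemma b_pos: "b > 0"
proof -
  obtain v where v: "v \<in> set_pmf p" using set_pmf_not_empty[of p] by auto
  then have "v \<in> G" using set_pmf_subset by auto
  then have "(pmf p v)\<^sup>2 \<le> (\<Sum>u\<in>G. (pmf p u)\<^sup>2)"
    by (intro member_le_sum) auto
  moreover have "(pmf p v)\<^sup>2 > 0" using v by (simp add: set_pmf_iff)
  ultimately show ?thesis using sum_p_sq by linarith
qed

text \<open>A single mass is at most the L2 norm. Together with \<open>q_le\<close> this yields
  bounds proportional to \<open>sqrt b * del\<close>, which shrink with the signal, instead of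
  multiples of \<open>b\<close>.\<close>

lemma p_le: "u \<in> G \<Longrightarrow> pmf p u \<le> sqrt b"
proof -
  assume "u \<in> G"
  then have "(pmf p u)\<^sup>2 \<le> (\<Sum>u\<in>G. (pmf p u)\<^sup>2)" by (intro member_le_sum) auto
  then show ?thesis using sum_p_sq by (intro real_le_rsqrt) linarith
qed

lemma q_le: "u \<in> G \<Longrightarrow> q u \<le> sqrt b"
proof -
  assume "u \<in> G"
  then have "(q u)\<^sup>2 \<le> (\<Sum>u\<in>G. (q u)\<^sup>2)" by (intro member_le_sum) auto
  then show ?thesis using sum_q_sq by (intro real_le_rsqrt) linarith
qed

lemma sum_delta_cross:
  assumes "fst v \<in> {1..d1}" "snd w \<in> {1..d2}"
  shows "(\<Sum>u\<in>G. of_bool (fst v = fst u) * of_bool (snd w = snd u) * f u) = (f (fst v, snd w) :: real)"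
proof -
  have "(\<Sum>u\<in>G. of_bool (fst v = fst u) * of_bool (snd w = snd u) * f u)
      = (\<Sum>u\<in>G. if u = (fst v, snd w) then f u else 0)"
    by (intro sum.cong refl) (auto simp: prod_eq_iff)
  also have "\<dots> = f (fst v, snd w)"
    using assms by (subst sum.delta) (auto simp: G_def)
  finally show ?thesis .
qed

text \<open>Components taken from different sample points are independent, so the mixed point has
  mass function \<open>q\<close>.\<close>

lemma E_cross:
  assumes "i \<in> {1..n}" "j \<in> {1..n}" "i \<noteq> j"
  shows "E (\<lambda>x. f (fst (x i), snd (x j))) = (\<Sum>u\<in>G. q u * f u)"
proof -
  have "E (\<lambda>x. f (fst (x i), snd (x j))) = (\<Sum>v\<in>G. \<Sum>w\<in>G. pmf p v * pmf p w * f (fst v, snd w))"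
    by (rule E_coord2[OF assms])
  \<comment> \<open>Expanding \<open>f\<close> at the mixed point over \<open>u\<close> separates
    \<open>v\<close> from \<open>w\<close>, and each inner sum becomes a marginal.\<close>
  also have "\<dots> = (\<Sum>v\<in>G. \<Sum>w\<in>G. pmf p v * pmf p w *
      (\<Sum>u\<in>G. of_bool (fst v = fst u) * of_bool (snd w = snd u) * f u))"
    by (intro sum.cong refl, subst sum_delta_cross) (auto simp: G_def)
  also have "\<dots> = (\<Sum>v\<in>G. \<Sum>w\<in>G. \<Sum>u\<in>G.
      (pmf p v * of_bool (fst v = fst u)) * (pmf p w * of_bool (snd w = snd u)) * f u)"
    by (simp add: sum_distrib_left mult_ac)
  also have "\<dots> = (\<Sum>u\<in>G. \<Sum>v\<in>G. \<Sum>w\<in>G.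
      (pmf p v * of_bool (fst v = fst u)) * (pmf p w * of_bool (snd w = snd u)) * f u)"
    by (subst (2) sum.swap, subst sum.swap) (rule refl)
  also have "\<dots> = (\<Sum>u\<in>G. q u * f u)"
    by (simp only: sum_distrib_right[symmetric] sum_distrib_left[symmetric] sum_p_fst sum_p_snd q_def)
  finally show ?thesis .
qed

lemma E_D_sq:
  assumes "i \<in> {1..n}"
  shows "E (\<lambda>x. (D (x i))\<^sup>2) \<le> sqrt b * del"
proof -
  have "E (\<lambda>x. (D (x i))\<^sup>2) = (\<Sum>u\<in>G. pmf p u * (D u)\<^sup>2)"
    by (rule E_coord[OF assms])
  also have "\<dots> \<le> (\<Sum>u\<in>G. sqrt b * (D u)\<^sup>2)"
    by (intro sum_mono mult_right_mono p_le) auto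
  finally show ?thesis by (simp add: del_def sum_distrib_left)
qed

lemma E_D_cross_sq:
  assumes "i \<in> {1..n}" "j \<in> {1..n}" "i \<noteq> j"
  shows "E (\<lambda>x. (D (fst (x i), snd (x j)))\<^sup>2) \<le> sqrt b * del"
proof -
  have "E (\<lambda>x. (D (fst (x i), snd (x j)))\<^sup>2) = (\<Sum>u\<in>G. q u * (D u)\<^sup>2)"
    by (rule E_cross[OF assms])
  also have "\<dots> \<le> (\<Sum>u\<in>G. sqrt b * (D u)\<^sup>2)"
    by (intro sum_mono mult_right_mono q_le) auto
  finally show ?thesis by (simp add: del_def sum_distrib_left)
qed

text \<open>The four indicator products in \<open>M\<close> pick out \<open>D\<close> at the two
  sample points and at the two points mixing their components; membership in \<open>G\<close> keeps
  these within the range of summation.\<close>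

lemma T_expand:
  assumes "x i \<in> G" "x j \<in> G"
  shows "T i j x = D (x i) - D (fst (x i), snd (x j)) - D (fst (x j), snd (x i)) + D (x j)"
proof -
  have "T i j x = (\<Sum>u\<in>G. of_bool (fst (x i) = fst u) * of_bool (snd (x i) = snd u) * D u
      - of_bool (fst (x i) = fst u) * of_bool (snd (x j) = snd u) * D u
      - of_bool (fst (x j) = fst u) * of_bool (snd (x i) = snd u) * D u
      + of_bool (fst (x j) = fst u) * of_bool (snd (x j) = snd u) * D u)"
    unfolding T_def M_def by (intro sum.cong refl) (simp only: algebra_simps)
  also have "\<dots> = D (fst (x i), snd (x i)) - D (fst (x i), snd (x j))
      - D (fst (x j), snd (x i)) + D (fst (x j), snd (x j))"
    unfolding sum.distrib sum_subtractf by (subst (1 2 3 4) sum_delta_cross) (use assms in \<open>auto simp: G_def\<close>)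
  finally show ?thesis by simp
qed

lemma E_T_sq:
  assumes "i \<in> {1..n}" "j \<in> {1..n}" "i \<noteq> j"
  shows "E (\<lambda>x. (T i j x)\<^sup>2) \<le> 16 * (sqrt b * del)"
proof -
  have "E (\<lambda>x. (T i j x)\<^sup>2) \<le> E (\<lambda>x. 4 * ((D (x i))\<^sup>2 + (D (fst (x i), snd (x j)))\<^sup>2
      + (D (fst (x j), snd (x i)))\<^sup>2 + (D (x j))\<^sup>2))"
    by (rule E_mono) (use assms in \<open>simp only: T_expand four_squares\<close>)
  also have "\<dots> \<le> 16 * (sqrt b * del)"
    unfolding E_cmult E_add
    using E_D_sq[OF assms(1)] E_D_sq[OF assms(2)] E_D_cross_sq[OF assms] E_D_cross_sq[OF assms(2,1)] assms(3)
    by simp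
  finally show ?thesis .
qed

text \<open>A pair of the first kernel that avoids the second one, and conversely, can be integrated out;
  this replaces two of the four factors by 2 D.\<close>

lemma E_KK:
  assumes "i \<in> {1..n}" "j \<in> {1..n}" "i \<noteq> j" "i' \<in> {1..n}" "j' \<in> {1..n}" "i' \<noteq> j'"
    and dj: "{i, j} \<inter> {k, l, i', j', k', l'} = {}" "{i', j'} \<inter> {k, l, k', l'} = {}"
  shows "E (\<lambda>x. K i j k l x * K i' j' k' l' x) = E (\<lambda>x. 4 * (T k l x * T k' l' x))"
proof -
  have "E (\<lambda>x. K i j k l x * K i' j' k' l' x) =
      E (\<lambda>x. \<Sum>u\<in>G. M u (x i) (x j) * (M u (x k) (x l) * K i' j' k' l' x))"
    by (simp add: K_def sum_distrib_right mult_ac)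
  also have "\<dots> = E (\<lambda>x. \<Sum>u\<in>G. 2 * D u * (M u (x k) (x l) * K i' j' k' l' x))"
    by (rule pair_avg) (use assms in \<open>auto simp: K_def\<close>)
  \<comment> \<open>The sum of \<open>D u * M u (x k) (x l)\<close> over \<open>u\<close> is
    \<open>T k l x\<close>; pulling it out exposes the pair \<open>i'\<close>, \<open>j'\<close> for
    the second integration.\<close>
  also have "\<dots> = E (\<lambda>x. \<Sum>u\<in>G. M u (x i') (x j') * (2 * T k l x * M u (x k') (x l')))"
    unfolding T_def K_def
    by (simp add: sum_distrib_right sum_distrib_left mult_ac)
      (rule arg_cong[of _ _ E], rule ext, subst sum.swap, simp add: mult_ac)
  also have "\<dots> = E (\<lambda>x. \<Sum>u\<in>G. 2 * D u * (2 * T k l x * M u (x k') (x l')))"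
    by (rule pair_avg) (use assms in \<open>auto simp: T_def\<close>)
  also have "\<dots> = E (\<lambda>x. 4 * (T k l x * T k' l' x))"
    by (subst (2) T_def) (simp add: sum_distrib_left mult_ac)
  finally show ?thesis .
qed

text \<open>The surviving pairs \<open>k\<close>, \<open>l\<close> and \<open>k'\<close>,
  \<open>l'\<close> may overlap. AM-GM separates the two \<open>T\<close> factors, and
  \<open>E_T_sq\<close> gives 64 = 2 * (16 + 16).\<close>

lemma E_KK_le:
  assumes "i \<in> {1..n}" "j \<in> {1..n}" "i \<noteq> j" "i' \<in> {1..n}" "j' \<in> {1..n}" "i' \<noteq> j'"
    and "k \<in> {1..n}" "l \<in> {1..n}" "k \<noteq> l" "k' \<in> {1..n}" "l' \<in> {1..n}" "k' \<noteq> l'"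
    and dj: "{i, j} \<inter> {k, l, i', j', k', l'} = {}" "{i', j'} \<inter> {k, l, k', l'} = {}"
  shows "E (\<lambda>x. K i j k l x * K i' j' k' l' x) \<le> 64 * (sqrt b * del)"
proof -
  have "E (\<lambda>x. K i j k l x * K i' j' k' l' x) = E (\<lambda>x. 4 * (T k l x * T k' l' x))"
    by (rule E_KK) fact+
  also have "\<dots> \<le> E (\<lambda>x. 2 * ((T k l x)\<^sup>2 + (T k' l' x)\<^sup>2))"
  proof (rule E_mono)
    fix x show "4 * (T k l x * T k' l' x) \<le> 2 * ((T k l x)\<^sup>2 + (T k' l' x)\<^sup>2)"
      using sum_squares_bound[of "T k l x" "T k' l' x"] by simp
  qed
  also have "\<dots> \<le> 64 * (sqrt b * del)"
    unfolding E_cmult E_add using E_T_sq[of k l] E_T_sq[of k' l'] assms by simp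
  finally show ?thesis .
qed

text \<open>\<open>pair_avg\<close> turns \<open>M u\<close> into \<open>2 * D u\<close>, which
  combines with the weight \<open>D u\<close> in \<open>T\<close> to the squares summed in
  \<open>del\<close>.\<close>

lemma E_T:
  assumes "i \<in> {1..n}" "j \<in> {1..n}" "i \<noteq> j"
    and "\<And>x v. F (x(i := v)) = F x" "\<And>x v. F (x(j := v)) = F x"
  shows "E (\<lambda>x. T i j x * F x) = 2 * del * E F"
proof -
  have "E (\<lambda>x. T i j x * F x) = E (\<lambda>x. \<Sum>u\<in>G. M u (x i) (x j) * (D u * F x))"
    by (simp add: T_def sum_distrib_right sum_distrib_left mult_ac)
  also have "\<dots> = E (\<lambda>x. \<Sum>u\<in>G. 2 * D u * (D u * F x))"
    by (rule pair_avg) (use assms in auto)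
  also have "\<dots> = E (\<lambda>x. 2 * del * F x)"
    by (simp add: del_def sum_distrib_left sum_distrib_right power2_eq_square mult_ac)
  finally show ?thesis by (simp add: E_cmult)
qed

text \<open>With all pairs disjoint, both \<open>T\<close> factors average to \<open>2 * del\<close>
  separately. The value is the square of the mean \<open>4 * del\<close> of a kernel, so such
  kernels are uncorrelated.\<close>

lemma E_KK_disjoint:
  assumes "i \<in> {1..n}" "j \<in> {1..n}" "i \<noteq> j" "i' \<in> {1..n}" "j' \<in> {1..n}" "i' \<noteq> j'"
    and "k \<in> {1..n}" "l \<in> {1..n}" "k \<noteq> l" "k' \<in> {1..n}" "l' \<in> {1..n}" "k' \<noteq> l'"
    and dj: "{i, j} \<inter> {k, l, i', j', k', l'} = {}" "{i', j'} \<inter> {k, l, k', l'} = {}"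
      "{k, l} \<inter> {k', l'} = {}"
  shows "E (\<lambda>x. K i j k l x * K i' j' k' l' x) = 16 * del\<^sup>2"
proof -
  have "E (\<lambda>x. K i j k l x * K i' j' k' l' x) = E (\<lambda>x. 4 * (T k l x * T k' l' x))"
    by (rule E_KK) fact+
  also have "\<dots> = 4 * (2 * del * E (T k' l'))"
    unfolding E_cmult by (subst E_T) (use assms in \<open>auto simp: T_def\<close>)
  also have "E (T k' l') = 2 * del"
    using E_T[of k' l' "\<lambda>_. 1"] assms by simp
  finally show ?thesis by (simp add: power2_eq_square)
qed

lemma E_K:
  assumes "i \<in> {1..n}" "j \<in> {1..n}" "i \<noteq> j" "k \<in> {1..n}" "l \<in> {1..n}" "k \<noteq> l" "{i, j} \<inter> {k, l} = {}"
  shows "E (K i j k l) = 4 * del"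
proof -
  have "E (K i j k l) = E (\<lambda>x. \<Sum>u\<in>G. 2 * D u * M u (x k) (x l))"
    unfolding K_def by (rule pair_avg) (use assms in auto)
  also have "\<dots> = E (\<lambda>x. 2 * (T k l x * 1))"
    by (simp add: T_def sum_distrib_left mult_ac)
  also have "\<dots> = 2 * (2 * del * 1)"
    unfolding E_cmult by (subst E_T) (use assms in auto)
  finally show ?thesis by simp
qed

end

section \<open>Second moments of the kernel on permuted samples\<close>

lemma g_kernel_eq: "u \<in> {1..d} \<Longrightarrow> g_kernel d u v = of_bool (u = v)"
proof -
  assume "u \<in> {1..d}"
  have "g_kernel d u v = (\<Sum>k\<in>{1..d}. if k = u then of_bool (u = v) else 0)"
    unfolding g_kernel_def by (intro sum.cong refl) auto
  also have "\<dots> = of_bool (u = v)"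
    using \<open>u \<in> {1..d}\<close> by (subst sum.delta) auto
  finally show ?thesis .
qed

text \<open>Matches are inner products of one-hot vectors, and by bilinearity the signed sum factors
  into the difference for points 1 and 4 against that for points 2 and 3. This decides how indices
  are paired in \<open>K\<close>.\<close>

lemma g_kernel_comb:
  "g_kernel d u1 u2 + g_kernel d u3 u4 - g_kernel d u1 u3 - g_kernel d u2 u4 =
   (\<Sum>k=1..d. (of_bool (u1 = k) - of_bool (u4 = k)) * (of_bool (u2 = k) - of_bool (u3 = k)))"
  unfolding g_kernel_def sum.distrib[symmetric] sum_subtractf[symmetric]
  by (intro sum.cong refl) (simp add: algebra_simps)

lemma permute_sample_id [simp]: "permute_sample id x = x"
  by (simp add: permute_sample_def)

context multinomial_sample
begin

lemma h_in_eq_sum: "h_in d1 d2 x1 x2 x3 x4 = (\<Sum>u\<in>G. M u x1 x4 * M u x2 x3)"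
  unfolding h_in_def g_kernel_comb sum_product G_def sum.cartesian_product M_def
  by (intro sum.cong refl) (auto simp: mult_ac)

lemma h_in_eq_K: "h_in d1 d2 (x i1) (x i2) (x i3) (x i4) = K i1 i4 i2 i3 x"
  by (simp add: h_in_eq_sum K_def)

lemma sum_p_fst': "(\<Sum>v\<in>G. pmf p v * of_bool (k = fst v)) = pY k"
  using sum_p_fst[of k] by (simp only: eq_commute[of k])

lemma sum_p_snd': "(\<Sum>v\<in>G. pmf p v * of_bool (k = snd v)) = pZ k"
  using sum_p_snd[of k] by (simp only: eq_commute[of k])

lemma E_agree_both:
  assumes "i \<in> {1..n}" "j \<in> {1..n}" "i \<noteq> j"
  shows "E (\<lambda>x. of_bool (fst (x i) = fst (x j)) * of_bool (snd (x i) = snd (x j))) \<le> b"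
proof -
  have "E (\<lambda>x. of_bool (fst (x i) = fst (x j)) * of_bool (snd (x i) = snd (x j)))
     = (\<Sum>v\<in>G. \<Sum>w\<in>G. pmf p v * pmf p w * (of_bool (fst v = fst w) * of_bool (snd v = snd w)))"
    by (rule E_coord2[OF assms])
  also have "\<dots> = (\<Sum>w\<in>G. pmf p w * (\<Sum>v\<in>G. pmf p v * (of_bool (fst v = fst w) * of_bool (snd v = snd w))))"
    by (subst sum.swap) (simp only: sum_distrib_left mult_ac)
  also have "\<dots> = (\<Sum>w\<in>G. (pmf p w)\<^sup>2)"
    by (simp only: sum_p_both power2_eq_square)
  finally show ?thesis using sum_p_sq by simp
qed

lemma E_agree_shared:
  assumes "i \<in> {1..n}" "j \<in> {1..n}" "k \<in> {1..n}" "i \<noteq> j" "i \<noteq> k" "j \<noteq> k"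
  shows "E (\<lambda>x. of_bool (fst (x i) = fst (x j)) * of_bool (snd (x i) = snd (x k))) \<le> b"
proof -
  have "E (\<lambda>x. of_bool (fst (x i) = fst (x j)) * of_bool (snd (x i) = snd (x k)))
      = E (\<lambda>x. \<Sum>v\<in>G. (pmf p v * of_bool (fst (x i) = fst v)) * of_bool (snd (x i) = snd (x k)))"
    using assms by (subst resample[of j]) (auto simp: mult_ac)
  also have "\<dots> = E (\<lambda>x. pY (fst (x i)) * of_bool (snd (x i) = snd (x k)))"
    by (simp only: sum_distrib_right[symmetric] sum_p_fst')
  also have "\<dots> = E (\<lambda>x. \<Sum>v\<in>G. pY (fst (x i)) * (pmf p v * of_bool (snd (x i) = snd v)))"
    using assms by (subst resample[of k]) (auto simp: mult_ac)
  also have "\<dots> = E (\<lambda>x. q (x i))"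
    by (simp only: sum_distrib_left[symmetric] sum_p_snd' q_def)
  also have "\<dots> \<le> b"
    using E_coord[OF assms(1), of q] sum_p_q by simp
  finally show ?thesis .
qed

lemma E_agree_disjoint:
  assumes "i \<in> {1..n}" "j \<in> {1..n}" "k \<in> {1..n}" "l \<in> {1..n}" "distinct [i, j, k, l]"
  shows "E (\<lambda>x. of_bool (fst (x i) = fst (x j)) * of_bool (snd (x k) = snd (x l))) \<le> b"
proof -
  have "E (\<lambda>x. of_bool (fst (x i) = fst (x j)) * of_bool (snd (x k) = snd (x l)))
      = E (\<lambda>x. \<Sum>v\<in>G. (pmf p v * of_bool (fst (x i) = fst v)) * of_bool (snd (x k) = snd (x l)))"
    using assms by (subst resample[of j]) (auto simp: mult_ac)
  also have "\<dots> = E (\<lambda>x. pY (fst (x i)) * of_bool (snd (x k) = snd (x l)))"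
    by (simp only: sum_distrib_right[symmetric] sum_p_fst')
  also have "\<dots> = E (\<lambda>x. \<Sum>v\<in>G. pY (fst (x i)) * (pmf p v * of_bool (snd (x k) = snd v)))"
    using assms by (subst resample[of l]) (auto simp: mult_ac)
  also have "\<dots> = E (\<lambda>x. q (fst (x i), snd (x k)))"
    by (simp only: sum_distrib_left[symmetric] sum_p_snd' q_def fst_conv snd_conv)
  also have "\<dots> = (\<Sum>u\<in>G. (q u)\<^sup>2)"
    using E_cross[of i k q] assms by (simp add: power2_eq_square)
  finally show ?thesis using sum_q_sq by simp
qed

text \<open>The overlap of the two index pairs decides the value: equal pairs give the sum of the
  squares of \<open>p\<close>, one shared index the sum of \<open>p\<close> times \<open>q\<close>,
  disjoint pairs the sum of the squares of \<open>q\<close>. All three are at most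
  \<open>b\<close>.\<close>

lemma E_agree:
  assumes "i \<in> {1..n}" "j \<in> {1..n}" "k \<in> {1..n}" "l \<in> {1..n}" "i \<noteq> j" "k \<noteq> l"
  shows "E (\<lambda>x. of_bool (fst (x i) = fst (x j)) * of_bool (snd (x k) = snd (x l))) \<le> b"
proof -
  consider "k = i" "l = j" | "k = j" "l = i" | "k = i" "l \<noteq> j" | "l = i" "k \<noteq> j"
    | "k = j" "l \<noteq> i" | "l = j" "k \<noteq> i" | "distinct [i, j, k, l]"
    using assms by auto
  then show ?thesis
  proof cases
    case 1 then show ?thesis using E_agree_both[of i j] assms by simp
  next
    case 2 then show ?thesis using E_agree_both[of i j] assms
      by (simp add: eq_commute[of "snd (_ j)" "snd (_ i)"])
  next
    case 3 then show ?thesis using E_agree_shared[of i j l] assms by simp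
  next
    case 4 then show ?thesis using E_agree_shared[of i j k] assms
      by (simp add: eq_commute[of "snd (_ k)" "snd (_ i)"])
  next
    case 5 then show ?thesis using E_agree_shared[of j i l] assms
      by (simp add: eq_commute[of "fst (_ j)" "fst (_ i)"])
  next
    case 6 then show ?thesis using E_agree_shared[of j i k] assms
      by (simp add: eq_commute[of "fst (_ j)" "fst (_ i)"] eq_commute[of "snd (_ j)" "snd (_ k)"])
  next
    case 7 then show ?thesis using E_agree_disjoint assms by blast
  qed
qed

text \<open>After a permutation the pairs compared in the first and in the second component can
  overlap in any way, hence the generality of \<open>E_agree\<close>. The constant is 4 * 4 * 16: a
  Cauchy-Schwarz factor 4 per component and sixteen products of matches.\<close>

lemma E_h_in_sq:
  assumes \<pi>: "\<pi> permutes {1..n}" and I: "{i1, i2, i3, i4} \<subseteq> {1..n}" "distinct [i1, i2, i3, i4]"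
  shows "E (\<lambda>x. (h_in d1 d2 (permute_sample \<pi> x i1) (permute_sample \<pi> x i2)
            (permute_sample \<pi> x i3) (permute_sample \<pi> x i4))\<^sup>2) \<le> 256 * b"
proof -
  define Y where "Y i j x = (of_bool (fst (x i) = fst (x j)) :: real)" for i j and x :: "nat \<Rightarrow> nat \<times> nat"
  define Z where "Z i j x = (of_bool (snd (x (\<pi> i)) = snd (x (\<pi> j))) :: real)" for i j and x :: "nat \<Rightarrow> nat \<times> nat"
  have in_range: "\<pi> i \<in> {1..n} \<longleftrightarrow> i \<in> {1..n}" for i
    using \<pi> by (rule permutes_in_image)
  have inj: "\<pi> i = \<pi> j \<longleftrightarrow> i = j" for i j
    using \<pi> by (rule permutes_inj[THEN inj_eq])
  have YZ: "E (\<lambda>x. Y i j x * Z k l x) \<le> b"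
    if "i \<in> {1..n}" "j \<in> {1..n}" "k \<in> {1..n}" "l \<in> {1..n}" "i \<noteq> j" "k \<noteq> l" for i j k l
    unfolding Y_def Z_def by (rule E_agree) (use that in \<open>simp_all only: in_range inj not_False_eq_True\<close>)
  define sY where "sY x = Y i1 i2 x + Y i3 i4 x + Y i1 i3 x + Y i2 i4 x" for x
  define sZ where "sZ x = Z i1 i2 x + Z i3 i4 x + Z i1 i3 x + Z i2 i4 x" for x
  have "E (\<lambda>x. (h_in d1 d2 (permute_sample \<pi> x i1) (permute_sample \<pi> x i2)
            (permute_sample \<pi> x i3) (permute_sample \<pi> x i4))\<^sup>2) \<le> E (\<lambda>x. 16 * (sY x * sZ x))"
  proof (rule E_mono)
    fix x :: "nat \<Rightarrow> nat \<times> nat"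
    assume x: "\<And>i. i \<in> {1..n} \<Longrightarrow> x i \<in> G"
    have gY: "g_kernel d1 (fst (x i)) (fst (x j)) = Y i j x" if "i \<in> {1..n}" for i j
      unfolding Y_def using x[OF that] by (intro g_kernel_eq) (auto simp: G_def)
    have gZ: "g_kernel d2 (snd (x (\<pi> i))) (snd (x (\<pi> j))) = Z i j x" if "i \<in> {1..n}" for i j
      unfolding Z_def using x[of "\<pi> i"] that in_range[of i] by (intro g_kernel_eq) (auto simp: G_def)
    \<comment> \<open>Matches are indicators and equal their squares, so the bound is linear in
      \<open>sY\<close> and in \<open>sZ\<close>.\<close>
    have Ysq: "(Y i j x)\<^sup>2 = Y i j x" and Zsq: "(Z i j x)\<^sup>2 = Z i j x" for i j
      by (simp_all add: Y_def Z_def)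
    have h: "h_in d1 d2 (permute_sample \<pi> x i1) (permute_sample \<pi> x i2)
            (permute_sample \<pi> x i3) (permute_sample \<pi> x i4)
       = (Y i1 i2 x - Y i1 i3 x - Y i2 i4 x + Y i3 i4 x) * (Z i1 i2 x - Z i1 i3 x - Z i2 i4 x + Z i3 i4 x)"
      unfolding h_in_def permute_sample_def fst_conv snd_conv
      using I by (intro arg_cong2[where f = "(*)"]) (simp_all add: gY gZ)
    have "(Y i1 i2 x - Y i1 i3 x - Y i2 i4 x + Y i3 i4 x)\<^sup>2 \<le> 4 * sY x"
      using four_squares[of "Y i1 i2 x" "Y i1 i3 x" "Y i2 i4 x" "Y i3 i4 x"] by (simp add: Ysq sY_def)
    moreover have "(Z i1 i2 x - Z i1 i3 x - Z i2 i4 x + Z i3 i4 x)\<^sup>2 \<le> 4 * sZ x"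
      using four_squares[of "Z i1 i2 x" "Z i1 i3 x" "Z i2 i4 x" "Z i3 i4 x"] by (simp add: Zsq sZ_def)
    ultimately have "(Y i1 i2 x - Y i1 i3 x - Y i2 i4 x + Y i3 i4 x)\<^sup>2 *
        (Z i1 i2 x - Z i1 i3 x - Z i2 i4 x + Z i3 i4 x)\<^sup>2 \<le> (4 * sY x) * (4 * sZ x)"
      by (intro mult_mono) (auto simp: sY_def Y_def)
    then show "(h_in d1 d2 (permute_sample \<pi> x i1) (permute_sample \<pi> x i2)
            (permute_sample \<pi> x i3) (permute_sample \<pi> x i4))\<^sup>2 \<le> 16 * (sY x * sZ x)"
      unfolding h power_mult_distrib by simp
  qed
  also have "\<dots> \<le> 16 * (b + b + b + b + (b + b + b + b) + (b + b + b + b) + (b + b + b + b))"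
    unfolding E_cmult sY_def sZ_def distrib_left distrib_right E_add
    by (intro add_mono mult_left_mono YZ order.refl) (use I in auto)
  finally show ?thesis by simp
qed

end

section \<open>Overlaps of index quadruples\<close>

definition quads :: "nat \<Rightarrow> (nat \<times> nat \<times> nat \<times> nat) set" where
  "quads n = {(i1, i2, i3, i4). {i1, i2, i3, i4} \<subseteq> {1..n} \<and> distinct [i1, i2, i3, i4]}"

definition entries :: "nat \<times> nat \<times> nat \<times> nat \<Rightarrow> nat set" where
  "entries = (\<lambda>(i1, i2, i3, i4). {i1, i2, i3, i4})"

definition meet_once where "meet_once I J \<longleftrightarrow> (\<exists>s. s \<in> entries I \<inter> entries J)"
definition meet_twice where "meet_twice I J \<longleftrightarrow> (\<exists>s t. s \<noteq> t \<and> {s, t} \<subseteq> entries I \<inter> entries J)"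

definition h_quad ::
  "nat \<Rightarrow> nat \<Rightarrow> (nat \<Rightarrow> nat \<times> nat) \<Rightarrow> nat \<times> nat \<times> nat \<times> nat \<Rightarrow> real" where
  "h_quad d1 d2 x = (\<lambda>(i1, i2, i3, i4). h_in d1 d2 (x i1) (x i2) (x i3) (x i4))"

lemma finite_quads [simp]: "finite (quads n)"
  by (rule finite_subset[of _ "{1..n} \<times> {1..n} \<times> {1..n} \<times> {1..n}"]) (auto simp: quads_def)

lemma card_quads:
  assumes "n \<ge> 4"
  shows "real (card (quads n)) = real n * (real n - 1) * (real n - 2) * (real n - 3)"
proof -
  define f where "f = (\<lambda>(a, b, c, d). [a, b, c, d :: nat])"
  have "inj_on f (quads n)" by (auto simp: inj_on_def f_def)
  moreover have "f ` quads n = {xs. length xs = 4 \<and> distinct xs \<and> set xs \<subseteq> {1..n}}" (is "_ = ?L")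
  proof
    show "f ` quads n \<subseteq> ?L" by (auto simp: f_def quads_def)
    show "?L \<subseteq> f ` quads n"
    proof
      fix xs assume xs: "xs \<in> ?L"
      then obtain a b c d where "xs = [a, b, c, d]"
        by (auto simp: numeral_eq_Suc length_Suc_conv)
      with xs have "xs = f (a, b, c, d)" "(a, b, c, d) \<in> quads n" by (auto simp: f_def quads_def)
      then show "xs \<in> f ` quads n" by blast
    qed
  qed
  ultimately have "card (quads n) = card ?L" by (metis card_image)
  also have "\<dots> = \<Prod>{n - 4 + 1..n}" by (subst card_lists_distinct_length_eq) (use assms in auto)
  also have "\<dots> = n * (n - 1) * (n - 2) * (n - 3)"
  proof -
    obtain m where m: "n = m + 4" using assms le_Suc_ex[of 4 n] by auto
    show ?thesis unfolding m
      by (simp add: numeral_eq_Suc prod.cl_ivl_Suc algebra_simps)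
  qed
  finally show ?thesis using assms by (simp add: of_nat_diff)
qed

text \<open>For n at least 4, n - k is at least (4 - k)/4 times n for k = 1, 2, 3, and 3/4 * 1/2 *
  1/4 = 3/32.\<close>

lemma card_quads_ge:
  assumes "n \<ge> 4"
  shows "real (card (quads n)) \<ge> 3 / 32 * real n ^ 4"
proof -
  have n: "real n \<ge> 4" using assms by simp
  have "3 / 32 * real n ^ 4 = real n * (3 / 4 * real n) * (1 / 2 * real n) * (1 / 4 * real n)"
    by (simp add: power4_eq_xxxx)
  also have "\<dots> \<le> real n * (real n - 1) * (real n - 2) * (real n - 3)"
    by (intro mult_mono) (use n in auto)
  finally show ?thesis using card_quads[OF assms] by simp
qed

lemma U_stat_eq:
  assumes "n \<ge> 4"
  shows "U_stat d1 d2 n x = (\<Sum>I\<in>quads n. h_quad d1 d2 x I) / real (card (quads n))"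
  by (subst card_quads[OF assms]) (simp only: U_stat_def quads_def h_quad_def times_divide_eq_left mult_1)

lemma card_entries: "I \<in> quads n \<Longrightarrow> card (entries I) = 4"
  by (auto simp: quads_def entries_def)

lemma finite_entries: "finite (entries I)"
  by (cases I) (simp add: entries_def)

lemma card_Un_le_add: "card A \<le> k \<Longrightarrow> card B \<le> l \<Longrightarrow> card (A \<union> B) \<le> k + l"
  by (meson add_mono card_Un_le order.trans)

text \<open>One of the four positions of \<open>J\<close> carries one of the four entries of
  \<open>I\<close>, and three positions are free: 4 * 4 = 16.\<close>

lemma card_meet_once:
  assumes "I \<in> quads n"
  shows "card {J \<in> quads n. meet_once I J} \<le> 16 * n ^ 3"
proof -
  define S where "S = entries I"
  define B where "B = {1..n}"
  have S: "card S = 4" "finite S" unfolding S_def using assms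
    by (simp_all add: card_entries finite_entries)
  have B: "card B = n" "finite B" by (auto simp: B_def)
  have "{J \<in> quads n. meet_once I J} \<subseteq>
      S \<times> B \<times> B \<times> B \<union> (B \<times> S \<times> B \<times> B \<union> (B \<times> B \<times> S \<times> B \<union> B \<times> B \<times> B \<times> S))"
  proof
    fix J assume "J \<in> {J \<in> quads n. meet_once I J}"
    then obtain j1 j2 j3 j4 s where J: "J = (j1, j2, j3, j4)" "{j1, j2, j3, j4} \<subseteq> B"
      and s: "s \<in> S" "s \<in> {j1, j2, j3, j4}"
      by (cases J) (auto simp: quads_def meet_once_def S_def B_def entries_def)
    from s J(2) show "J \<in> S \<times> B \<times> B \<times> B \<union> (B \<times> S \<times> B \<times> B \<union> (B \<times> B \<times> S \<times> B \<union> B \<times> B \<times> B \<times> S))"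
      unfolding J(1) by (elim insertE) auto
  qed
  then have "card {J \<in> quads n. meet_once I J} \<le> card (
      S \<times> B \<times> B \<times> B \<union> (B \<times> S \<times> B \<times> B \<union> (B \<times> B \<times> S \<times> B \<union> B \<times> B \<times> B \<times> S)))"
    by (intro card_mono) (use S B in auto)
  also have "\<dots> \<le> card (S \<times> B \<times> B \<times> B) + (card (B \<times> S \<times> B \<times> B) + (card (B \<times> B \<times> S \<times> B) + card (B \<times> B \<times> B \<times> S)))"
    by (intro card_Un_le_add order.refl)
  also have "\<dots> = 16 * n ^ 3"
    using S B by (simp add: card_cartesian_product power3_eq_cube)
  finally show ?thesis .
qed

text \<open>Six choices of two positions, sixteen ways to fill them from \<open>I\<close>, and two
  free positions: 6 * 16 = 96.\<close>

lemma card_meet_twice: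
  assumes "I \<in> quads n"
  shows "card {J \<in> quads n. meet_twice I J} \<le> 96 * n\<^sup>2"
proof -
  define S where "S = entries I"
  define B where "B = {1..n}"
  have S: "card S = 4" "finite S" unfolding S_def using assms
    by (simp_all add: card_entries finite_entries)
  have B: "card B = n" "finite B" by (auto simp: B_def)
  have "{J \<in> quads n. meet_twice I J} \<subseteq>
      S \<times> S \<times> B \<times> B \<union> (S \<times> B \<times> S \<times> B \<union> (S \<times> B \<times> B \<times> S \<union>
      (B \<times> S \<times> S \<times> B \<union> (B \<times> S \<times> B \<times> S \<union> B \<times> B \<times> S \<times> S))))"
  proof
    fix J assume "J \<in> {J \<in> quads n. meet_twice I J}"
    then obtain j1 j2 j3 j4 s t where J: "J = (j1, j2, j3, j4)" "{j1, j2, j3, j4} \<subseteq> B"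
      and st: "s \<noteq> t" "s \<in> S" "t \<in> S" "s \<in> {j1, j2, j3, j4}" "t \<in> {j1, j2, j3, j4}"
      by (cases J) (auto simp: quads_def meet_twice_def S_def B_def entries_def)
    from st J(2) show "J \<in> S \<times> S \<times> B \<times> B \<union> (S \<times> B \<times> S \<times> B \<union> (S \<times> B \<times> B \<times> S \<union>
      (B \<times> S \<times> S \<times> B \<union> (B \<times> S \<times> B \<times> S \<union> B \<times> B \<times> S \<times> S))))"
      unfolding J(1) by (elim insertE) auto
  qed
  then have "card {J \<in> quads n. meet_twice I J} \<le> card (
      S \<times> S \<times> B \<times> B \<union> (S \<times> B \<times> S \<times> B \<union> (S \<times> B \<times> B \<times> S \<union>
      (B \<times> S \<times> S \<times> B \<union> (B \<times> S \<times> B \<times> S \<union> B \<times> B \<times> S \<times> S)))))"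
    by (intro card_mono) (use S B in auto)
  also have "\<dots> \<le> card (S \<times> S \<times> B \<times> B) + (card (S \<times> B \<times> S \<times> B) + (card (S \<times> B \<times> B \<times> S) +
      (card (B \<times> S \<times> S \<times> B) + (card (B \<times> S \<times> B \<times> S) + card (B \<times> B \<times> S \<times> S)))))"
    by (intro card_Un_le_add order.refl)
  also have "\<dots> = 96 * n\<^sup>2"
    using S B by (simp add: card_cartesian_product power2_eq_square)
  finally show ?thesis .
qed

text \<open>The two pairs are disjoint, so hits of \<open>J\<close> in both would be two distinct
  common indices. The avoiding pair is the one later integrated out or transposed.\<close>

lemma not_meet_twice_avoid:
  assumes "\<not> meet_twice (i1, i2, i3, i4) J" "distinct [i1, i2, i3, i4]"
  shows "{i1, i4} \<inter> entries J = {} \<or> {i2, i3} \<inter> entries J = {}"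
proof (rule ccontr)
  assume "\<not> ?thesis"
  then obtain s t where "s \<in> {i1, i4}" "s \<in> entries J" "t \<in> {i2, i3}" "t \<in> entries J" by blast
  with assms show False
    unfolding meet_twice_def entries_def by auto
qed

lemma meet_twice_sym: "meet_twice I J \<longleftrightarrow> meet_twice J I"
  unfolding meet_twice_def by blast

section \<open>Variance of the U-statistic\<close>

context multinomial_sample
begin

abbreviation "h \<equiv> h_quad d1 d2"

lemma E_h_sq:
  assumes "\<pi> permutes {1..n}" "I \<in> quads n"
  shows "E (\<lambda>x. (h (permute_sample \<pi> x) I)\<^sup>2) \<le> 256 * b"
  using E_h_in_sq[OF assms(1)] assms(2) by (auto simp: h_quad_def quads_def)

lemma E_hh_le:
  assumes "\<pi> permutes {1..n}" "I \<in> quads n" "J \<in> quads n"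
  shows "E (\<lambda>x. h (permute_sample \<pi> x) I * h (permute_sample \<pi> x) J) \<le> 256 * b"
proof -
  have "E (\<lambda>x. h (permute_sample \<pi> x) I * h (permute_sample \<pi> x) J)
      \<le> E (\<lambda>x. 1 / 2 * ((h (permute_sample \<pi> x) I)\<^sup>2 + (h (permute_sample \<pi> x) J)\<^sup>2))"
  proof (rule E_mono)
    fix x
    show "h (permute_sample \<pi> x) I * h (permute_sample \<pi> x) J
        \<le> 1 / 2 * ((h (permute_sample \<pi> x) I)\<^sup>2 + (h (permute_sample \<pi> x) J)\<^sup>2)"
      using sum_squares_bound[of "h (permute_sample \<pi> x) I" "h (permute_sample \<pi> x) J"] by simp
  qed
  also have "\<dots> \<le> 256 * b"
    unfolding E_cmult E_add using E_h_sq[OF assms(1,2)] E_h_sq[OF assms(1,3)] by simp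
  finally show ?thesis .
qed

lemma K_swap: "K i j k l = K k l i j"
  by (simp add: K_def fun_eq_iff mult.commute)

lemma E_h: "I \<in> quads n \<Longrightarrow> E (\<lambda>x. h x I) = 4 * del"
  by (cases I) (auto simp: h_quad_def h_in_eq_K quads_def intro!: E_K)

lemma del_nonneg: "del \<ge> 0"
  by (simp add: del_def sum_nonneg)

lemma E_KK_le_sets:
  assumes "{i, j, k, l} \<subseteq> {1..n}" "distinct [i, j, k, l]"
    and "{i', j', k', l'} \<subseteq> {1..n}" "distinct [i', j', k', l']"
    and "{i, j} \<inter> {i', j', k', l'} = {}" "{i', j'} \<inter> {i, j, k, l} = {}"
  shows "E (\<lambda>x. K i j k l x * K i' j' k' l' x) \<le> 64 * (sqrt b * del)"
  by (rule E_KK_le) (use assms in auto)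

lemma E_KK_disjoint_sets:
  assumes "{i, j, k, l} \<subseteq> {1..n}" "distinct [i, j, k, l]"
    and "{i', j', k', l'} \<subseteq> {1..n}" "distinct [i', j', k', l']"
    and "{i, j, k, l} \<inter> {i', j', k', l'} = {}"
  shows "E (\<lambda>x. K i j k l x * K i' j' k' l' x) = 16 * del\<^sup>2"
  by (rule E_KK_disjoint) (use assms in auto)

text \<open>Disjoint quadruples are uncorrelated. If just one index is shared, each quadruple has a
  pair avoiding the other, and \<open>E_KK_le_sets\<close> keeps the small factor
  \<open>sqrt b * del\<close>. Two shared indices leave only the crude second moment.\<close>

lemma E_hh_cov:
  assumes I: "I \<in> quads n" and J: "J \<in> quads n"
  shows "E (\<lambda>x. h x I * h x J) - 16 * del\<^sup>2
     \<le> 64 * (sqrt b * del) * of_bool (meet_once I J) + 256 * b * of_bool (meet_twice I J)"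
proof -
  obtain i1 i2 i3 i4 where I': "I = (i1, i2, i3, i4)" by (cases I)
  obtain j1 j2 j3 j4 where J': "J = (j1, j2, j3, j4)" by (cases J)
  have hK: "h x I = K i1 i4 i2 i3 x" "h x J = K j1 j4 j2 j3 x" for x
    by (simp_all add: I' J' h_quad_def h_in_eq_K)
  have nn: "sqrt b * del \<ge> 0" using b_pos del_nonneg by simp
  have ri: "i1 \<in> {1..n}" "i2 \<in> {1..n}" "i3 \<in> {1..n}" "i4 \<in> {1..n}" "distinct [i1, i2, i3, i4]"
    using I by (auto simp: I' quads_def)
  have rj: "j1 \<in> {1..n}" "j2 \<in> {1..n}" "j3 \<in> {1..n}" "j4 \<in> {1..n}" "distinct [j1, j2, j3, j4]"
    using J by (auto simp: J' quads_def)
  \<comment> \<open>The symmetry lets whichever pair avoids the other quadruple come first, as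
    \<open>E_KK_le_sets\<close> demands.\<close>
  have Ki: "K i1 i4 i2 i3 = K i2 i3 i1 i4" and Kj: "K j1 j4 j2 j3 = K j2 j3 j1 j4"
    by (rule K_swap)+
  show ?thesis
  proof (cases "meet_twice I J")
    case True
    then have "E (\<lambda>x. h x I * h x J) \<le> 256 * b * of_bool (meet_twice I J)"
      using E_hh_le[OF permutes_id I J] by simp
    moreover have "0 \<le> 64 * (sqrt b * del) * of_bool (meet_once I J)" using nn by simp
    moreover have "0 \<le> 16 * del\<^sup>2" by simp
    ultimately show ?thesis by linarith
  next
    case not2: False
    show ?thesis
    proof (cases "meet_once I J")
      case True
      have "{i1, i4} \<inter> entries J = {} \<or> {i2, i3} \<inter> entries J = {}"
        using not2 ri unfolding I' by (intro not_meet_twice_avoid)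
      moreover have "{j1, j4} \<inter> entries I = {} \<or> {j2, j3} \<inter> entries I = {}"
        using not2 rj unfolding J' by (intro not_meet_twice_avoid) (auto simp: meet_twice_sym)
      ultimately have "E (\<lambda>x. K i1 i4 i2 i3 x * K j1 j4 j2 j3 x) \<le> 64 * (sqrt b * del)"
      proof (elim disjE)
        assume "{i1, i4} \<inter> entries J = {}" "{j1, j4} \<inter> entries I = {}"
        then have "E (\<lambda>x. K i1 i4 i2 i3 x * K j1 j4 j2 j3 x) \<le> 64 * (sqrt b * del)"
          by (intro E_KK_le_sets) (use ri rj in \<open>simp_all only: entries_def I' J' prod.case, auto\<close>)
        then show ?thesis .
      next
        assume "{i1, i4} \<inter> entries J = {}" "{j2, j3} \<inter> entries I = {}"
        then have "E (\<lambda>x. K i1 i4 i2 i3 x * K j2 j3 j1 j4 x) \<le> 64 * (sqrt b * del)"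
          by (intro E_KK_le_sets) (use ri rj in \<open>simp_all only: entries_def I' J' prod.case, auto\<close>)
        then show ?thesis by (simp only: Kj)
      next
        assume "{i2, i3} \<inter> entries J = {}" "{j1, j4} \<inter> entries I = {}"
        then have "E (\<lambda>x. K i2 i3 i1 i4 x * K j1 j4 j2 j3 x) \<le> 64 * (sqrt b * del)"
          by (intro E_KK_le_sets) (use ri rj in \<open>simp_all only: entries_def I' J' prod.case, auto\<close>)
        then show ?thesis by (simp only: Ki)
      next
        assume "{i2, i3} \<inter> entries J = {}" "{j2, j3} \<inter> entries I = {}"
        then have "E (\<lambda>x. K i2 i3 i1 i4 x * K j2 j3 j1 j4 x) \<le> 64 * (sqrt b * del)"
          by (intro E_KK_le_sets) (use ri rj in \<open>simp_all only: entries_def I' J' prod.case, auto\<close>)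
        then show ?thesis by (simp only: Ki Kj)
      qed
      moreover have "0 \<le> 16 * del\<^sup>2" by simp
      ultimately have "E (\<lambda>x. K i1 i4 i2 i3 x * K j1 j4 j2 j3 x) - 16 * del\<^sup>2 \<le> 64 * (sqrt b * del)"
        by linarith
      then show ?thesis using True not2 by (simp add: hK)
    next
      case False
      then have "{i1, i2, i3, i4} \<inter> {j1, j2, j3, j4} = {}"
        unfolding meet_once_def I' J' entries_def by blast
      then have "E (\<lambda>x. K i1 i4 i2 i3 x * K j1 j4 j2 j3 x) = 16 * del\<^sup>2"
        by (intro E_KK_disjoint_sets) (use ri rj in auto)
      then show ?thesis using False not2 by (simp add: hK)
    qed
  qed
qed

lemma U_variance:
  assumes n: "n \<ge> 4"
  shows "E (\<lambda>x. (U_stat d1 d2 n x - 4 * del)\<^sup>2)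
     \<le> (1024 * (sqrt b * del) * real n ^ 3 + 24576 * b * (real n)\<^sup>2) / real (card (quads n))"
proof -
  define N where "N = real (card (quads n))"
  \<comment> \<open>A bound for each row sum of covariances: 1024 = 64 * 16 and 24576 = 256 * 96
    multiply covariance bounds by overlap counts. With \<open>N\<close> rows the variance is at most
    \<open>B / N\<close>.\<close>
  define B where "B = 1024 * (sqrt b * del) * real n ^ 3 + 24576 * b * (real n)\<^sup>2"
  have N: "N > 0" unfolding N_def using card_quads_ge[OF n] n
    by (intro less_le_trans[OF _ card_quads_ge[OF n]]) auto
  then have ne: "quads n \<noteq> {}" by (auto simp: N_def)
  have "E (\<lambda>x. (U_stat d1 d2 n x - 4 * del)\<^sup>2) = E (\<lambda>x. 1 / N\<^sup>2 * (\<Sum>I\<in>quads n. \<Sum>J\<in>quads n.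
        (h x I - 4 * del) * (h x J - 4 * del)))"
  proof (rule arg_cong[of _ _ E], rule ext)
    fix x
    have "U_stat d1 d2 n x - 4 * del = (\<Sum>I\<in>quads n. h x I - 4 * del) / N"
      using N ne by (simp add: U_stat_eq[OF n] sum_subtractf N_def diff_divide_distrib)
    then show "(U_stat d1 d2 n x - 4 * del)\<^sup>2 = 1 / N\<^sup>2 * (\<Sum>I\<in>quads n. \<Sum>J\<in>quads n.
        (h x I - 4 * del) * (h x J - 4 * del))"
      by (simp add: power_divide sum_product power2_eq_square)
  qed
  also have "\<dots> = 1 / N\<^sup>2 * (\<Sum>I\<in>quads n. \<Sum>J\<in>quads n. E (\<lambda>x. (h x I - 4 * del) * (h x J - 4 * del)))"
    by (simp only: E_cmult E_sum)
  also have "\<dots> = 1 / N\<^sup>2 * (\<Sum>I\<in>quads n. \<Sum>J\<in>quads n. E (\<lambda>x. h x I * h x J) - 16 * del\<^sup>2)"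
  proof -
    have "E (\<lambda>x. (h x I - 4 * del) * (h x J - 4 * del)) = E (\<lambda>x. h x I * h x J) - 16 * del\<^sup>2"
      if "I \<in> quads n" "J \<in> quads n" for I J
    proof -
      have "E (\<lambda>x. (h x I - 4 * del) * (h x J - 4 * del))
         = E (\<lambda>x. h x I * h x J - 4 * del * h x I - 4 * del * h x J + 16 * del\<^sup>2)"
        by (simp add: algebra_simps power2_eq_square)
      also have "\<dots> = E (\<lambda>x. h x I * h x J) - 16 * del\<^sup>2"
        unfolding E_add E_diff E_cmult E_h[OF that(1)] E_h[OF that(2)]
        by (simp add: power2_eq_square)
      finally show ?thesis .
    qed
    then show ?thesis by simp
  qed
  also have "\<dots> \<le> 1 / N\<^sup>2 * (\<Sum>I\<in>quads n. B)"
  proof (intro mult_left_mono sum_mono)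
    fix I assume I: "I \<in> quads n"
    have "(\<Sum>J\<in>quads n. E (\<lambda>x. h x I * h x J) - 16 * del\<^sup>2) \<le> (\<Sum>J\<in>quads n.
        64 * (sqrt b * del) * of_bool (meet_once I J) + 256 * b * of_bool (meet_twice I J))"
      by (intro sum_mono E_hh_cov I)
    also have "\<dots> = 64 * (sqrt b * del) * real (card {J \<in> quads n. meet_once I J})
        + 256 * b * real (card {J \<in> quads n. meet_twice I J})"
      unfolding sum.distrib sum_distrib_left[symmetric] by (simp only: sum_of_bool_card finite_quads)
    also have "\<dots> \<le> 64 * (sqrt b * del) * real (16 * n ^ 3) + 256 * b * real (96 * n\<^sup>2)"
      using card_meet_once[OF I] card_meet_twice[OF I] b_pos del_nonneg
      by (intro add_mono mult_left_mono) (simp_all only: of_nat_le_iff, auto)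
    finally show "(\<Sum>J\<in>quads n. E (\<lambda>x. h x I * h x J) - 16 * del\<^sup>2) \<le> B" by (simp add: B_def)
  qed simp
  also have "\<dots> = B / N"
    using N by (simp add: power2_eq_square N_def)
  finally show ?thesis by (simp add: B_def N_def)
qed

end

section \<open>The permutation distribution\<close>

text \<open>The empirical distribution function jumps only at values of \<open>f\<close>, so the
  infimum is a minimum over finitely many of them. Positivity of \<open>q\<close> keeps thresholds
  below all values out of \<open>S\<close>; the upper bound on \<open>q\<close> makes
  \<open>S\<close> nonempty.\<close>

lemma Inf_quantile:
  fixes f :: "'a \<Rightarrow> real" and q k :: real
  assumes P: "finite P" and q: "0 < q" "q \<le> k * card P"
  defines "S \<equiv> {t. k * (\<Sum>\<pi>\<in>P. of_bool (f \<pi> \<le> t)) \<ge> q}"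
  shows "Inf S \<in> S" and "t \<in> S \<Longrightarrow> Inf S \<le> t"
proof -
  have P_ne: "P \<noteq> {}" using q by auto
  \<comment> \<open>Lowering \<open>t\<close> to the largest value of \<open>f\<close> not exceeding
    it leaves the count unchanged.\<close>
  have below: "\<exists>\<pi>\<in>P. f \<pi> \<le> t \<and> f \<pi> \<in> S" if t: "t \<in> S" for t
  proof -
    define A where "A = {\<pi>\<in>P. f \<pi> \<le> t}"
    have "A \<noteq> {}"
    proof
      assume "A = {}"
      then have "(\<Sum>\<pi>\<in>P. of_bool (f \<pi> \<le> t)) = (0 :: real)"
        by (intro sum.neutral) (auto simp: A_def)
      with t q show False by (simp add: S_def)
    qed
    moreover have A: "finite A" using P by (simp add: A_def)
    ultimately have "Max (f ` A) \<in> f ` A" by (intro Max_in) auto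
    then obtain \<pi> where \<pi>: "\<pi> \<in> A" "f \<pi> = Max (f ` A)" by auto
    have "f \<rho> \<le> f \<pi> \<longleftrightarrow> f \<rho> \<le> t" if "\<rho> \<in> P" for \<rho>
    proof
      assume "f \<rho> \<le> t"
      then have "\<rho> \<in> A" using that by (simp add: A_def)
      then show "f \<rho> \<le> f \<pi>" unfolding \<pi>(2) using A by (intro Max_ge) auto
    qed (use \<pi>(1) in \<open>auto simp: A_def\<close>)
    then have "(\<Sum>\<rho>\<in>P. of_bool (f \<rho> \<le> f \<pi>)) = (\<Sum>\<rho>\<in>P. of_bool (f \<rho> \<le> t) :: real)"
      by (intro sum.cong) auto
    then have "f \<pi> \<in> S" using t by (simp only: S_def mem_Collect_eq)
    then show ?thesis using \<pi>(1) by (auto simp: A_def)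
  qed
  have "(\<Sum>\<pi>\<in>P. of_bool (f \<pi> \<le> Max (f ` P)) :: real) = card P"
    using P by (simp add: Int_absorb2 subset_iff)
  then have "Max (f ` P) \<in> S" using q by (simp only: S_def mem_Collect_eq)
  then have ne: "f ` P \<inter> S \<noteq> {}" using below by blast
  have fin: "finite (f ` P \<inter> S)" using P by simp
  have min: "Min (f ` P \<inter> S) \<in> S" using Min_in[OF fin ne] by blast
  have le: "Min (f ` P \<inter> S) \<le> t" if t: "t \<in> S" for t
  proof -
    obtain \<pi> where "\<pi> \<in> P" "f \<pi> \<le> t" "f \<pi> \<in> S" using below[OF t] by blast
    then show ?thesis using Min_le[OF fin, of "f \<pi>"] by auto
  qed
  have "Inf S = Min (f ` P \<inter> S)" by (rule cInf_eq_minimum[OF min le])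
  then show "Inf S \<in> S" and "t \<in> S \<Longrightarrow> Inf S \<le> t" using min le by auto
qed

lemma card_perms: "card {\<pi>. \<pi> permutes {1..n::nat}} = fact n"
  by (rule card_permutations) auto

lemma finite_perms: "finite {\<pi>. \<pi> permutes {1..n::nat}}"
  by (rule finite_permutations) simp

lemma permute_sample_comp: "permute_sample \<tau> (permute_sample \<sigma> x) = permute_sample (\<sigma> \<circ> \<tau>) x"
  by (simp add: permute_sample_def)

text \<open>Permuting the sample first is a left translation in the group, which only reorders the
  sum over all permutations.\<close>

lemma crit_value_permute:
  assumes \<sigma>: "\<sigma> permutes {1..n}"
  shows "crit_value d1 d2 n \<alpha> (permute_sample \<sigma> x) = crit_value d1 d2 n \<alpha> x"
  unfolding crit_value_def permute_sample_comp
  by (simp only: setum_permutations_compose_left[OF \<sigma>, symmetric,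
        where f = "\<lambda>\<pi>. of_bool (U_stat d1 d2 n (permute_sample \<pi> x) \<le> t)" for t])

section \<open>Level and size of the critical value\<close>

context
  fixes d1 d2 n :: nat and \<alpha> :: real and x :: "nat \<Rightarrow> nat \<times> nat"
  assumes \<alpha>: "0 < \<alpha>" "\<alpha> < 1"
begin

lemma quantile_level: "0 < 1 - \<alpha>" "1 - \<alpha> \<le> 1 / fact n * real (card {\<pi>. \<pi> permutes {1..n}})"
  using \<alpha> by (simp_all add: card_perms[simplified])

text \<open>The infimum defining the quantile is attained, so at least a fraction
  \<open>1 - \<alpha>\<close> of the permuted statistics lies at or below it; this counts the
  rest.\<close>

lemma permuted_exceed_crit_value:
  "(\<Sum>\<pi> | \<pi> permutes {1..n}. of_bool (U_stat d1 d2 n (permute_sample \<pi> x) > crit_value d1 d2 n \<alpha> x)) \<le> \<alpha> * fact n"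
proof -
  let ?P = "{\<pi>. \<pi> permutes {1..n}}"
  let ?c = "crit_value d1 d2 n \<alpha> x" and ?U = "\<lambda>\<pi>. U_stat d1 d2 n (permute_sample \<pi> x)"
  have "1 - \<alpha> \<le> 1 / fact n * (\<Sum>\<pi>\<in>?P. of_bool (?U \<pi> \<le> ?c))"
    using Inf_quantile(1)[OF finite_perms quantile_level, of ?U]
    unfolding crit_value_def by (simp only: mem_Collect_eq)
  then have "(1 - \<alpha>) * fact n \<le> (\<Sum>\<pi>\<in>?P. of_bool (?U \<pi> \<le> ?c))"
    by (simp add: field_simps)
  moreover have "(\<Sum>\<pi>\<in>?P. of_bool (?U \<pi> > ?c)) = (\<Sum>\<pi>\<in>?P. 1 - of_bool (?U \<pi> \<le> ?c) :: real)"
    by (intro sum.cong) auto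
  moreover have "\<dots> = fact n - (\<Sum>\<pi>\<in>?P. of_bool (?U \<pi> \<le> ?c))"
    unfolding sum_subtractf by (simp add: card_perms[simplified])
  ultimately show ?thesis by (simp only: left_diff_distrib mult_1)
qed

text \<open>Chebyshev's inequality for the permutation distribution.\<close>

lemma crit_value_le:
  assumes t: "t > 0"
    and le: "(\<Sum>\<pi> | \<pi> permutes {1..n}. (U_stat d1 d2 n (permute_sample \<pi> x))\<^sup>2) / fact n \<le> \<alpha> * t\<^sup>2"
  shows "crit_value d1 d2 n \<alpha> x \<le> t"
proof -
  let ?P = "{\<pi>. \<pi> permutes {1..n}}"
  let ?U = "\<lambda>\<pi>. U_stat d1 d2 n (permute_sample \<pi> x)"
  have "(\<Sum>\<pi>\<in>?P. (1 - of_bool (?U \<pi> \<le> t)) * t\<^sup>2) \<le> (\<Sum>\<pi>\<in>?P. (?U \<pi>)\<^sup>2)"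
  proof (rule sum_mono)
    fix \<pi>
    show "(1 - of_bool (?U \<pi> \<le> t)) * t\<^sup>2 \<le> (?U \<pi>)\<^sup>2"
      using t by (cases "?U \<pi> \<le> t") (auto intro!: power_mono)
  qed
  also have "\<dots> \<le> \<alpha> * t\<^sup>2 * fact n" using le by (simp add: field_simps)
  finally have "(fact n - (\<Sum>\<pi>\<in>?P. of_bool (?U \<pi> \<le> t))) * t\<^sup>2 \<le> \<alpha> * fact n * t\<^sup>2"
    unfolding sum_distrib_right[symmetric] sum_subtractf by (simp add: card_perms[simplified] mult_ac)
  then have "fact n - (\<Sum>\<pi>\<in>?P. of_bool (?U \<pi> \<le> t)) \<le> \<alpha> * fact n"
    using t by (simp only: mult_le_cancel_right) (auto simp: not_less)
  then have "1 - \<alpha> \<le> 1 / fact n * (\<Sum>\<pi>\<in>?P. of_bool (?U \<pi> \<le> t))"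
    by (simp add: field_simps)
  then show ?thesis
    using Inf_quantile(2)[OF finite_perms quantile_level, of t ?U]
    unfolding crit_value_def by (simp only: mem_Collect_eq)
qed

text \<open>The threshold is \<open>2 * \<delta>\<close>, half of the mean
  \<open>4 * \<delta>\<close> that the statistic has for \<open>\<delta> = del\<close>. On
  acceptance, either the statistic misses \<open>4 * \<delta>\<close> by at least
  \<open>2 * \<delta>\<close>, or the critical value exceeds \<open>2 * \<delta>\<close> and
  \<open>crit_value_le\<close> forces a large second permutation moment. The resulting bound can be
  integrated termwise.\<close>

lemma type_II_pointwise:
  assumes del: "\<delta> > 0"
  shows "of_bool (U_stat d1 d2 n x \<le> crit_value d1 d2 n \<alpha> x) \<le>
      1 / (4 * \<delta>\<^sup>2) * (U_stat d1 d2 n x - 4 * \<delta>)\<^sup>2 + 1 / (4 * \<alpha> * \<delta>\<^sup>2) *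
      ((\<Sum>\<pi> | \<pi> permutes {1..n}. (U_stat d1 d2 n (permute_sample \<pi> x))\<^sup>2) / fact n)"
    (is "of_bool (?U \<le> ?c) \<le> _ + _ * ?Q")
proof -
  let ?V = "(?U - 4 * \<delta>)\<^sup>2 / (4 * \<delta>\<^sup>2)"
  have nn: "?V \<ge> 0" "?Q / (4 * \<alpha> * \<delta>\<^sup>2) \<ge> 0"
    using \<alpha> by (auto intro!: divide_nonneg_nonneg sum_nonneg)
  have big: "?V \<ge> 1 \<or> ?Q / (4 * \<alpha> * \<delta>\<^sup>2) \<ge> 1" if Uc: "?U \<le> ?c"
  proof (cases "?U \<le> 2 * \<delta>")
    case True
    then have "(2 * \<delta>)\<^sup>2 \<le> (4 * \<delta> - ?U)\<^sup>2" using del by (intro power_mono) auto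
    then have "4 * \<delta>\<^sup>2 \<le> (?U - 4 * \<delta>)\<^sup>2" by (simp add: power2_commute)
    then show ?thesis using del by simp
  next
    case False
    then have "\<not> ?c \<le> 2 * \<delta>" using Uc by linarith
    then have "\<not> ?Q \<le> \<alpha> * (2 * \<delta>)\<^sup>2" using crit_value_le[of "2 * \<delta>"] del by auto
    then have "4 * \<alpha> * \<delta>\<^sup>2 \<le> ?Q" by (simp add: power_mult_distrib mult_ac)
    moreover have "4 * \<alpha> * \<delta>\<^sup>2 > 0" using del \<alpha> by simp
    ultimately have "?Q / (4 * \<alpha> * \<delta>\<^sup>2) \<ge> 1" by (simp only: le_divide_eq_1_pos)
    then show ?thesis by (rule disjI2)
  qed
  have "of_bool (?U \<le> ?c) \<le> ?V + ?Q / (4 * \<alpha> * \<delta>\<^sup>2)"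
  proof (cases "?U \<le> ?c")
    case True
    with big nn have "1 \<le> ?V + ?Q / (4 * \<alpha> * \<delta>\<^sup>2)" by (meson add_increasing add_increasing2)
    with True show ?thesis by (simp only: of_bool_eq)
  next
    case False
    with nn show ?thesis by (simp only: of_bool_eq add_nonneg_nonneg)
  qed
  then show ?thesis by (simp only: times_divide_eq_left mult_1)
qed

end

section \<open>Cancellation under transpositions\<close>

lemma g_kernel_commute: "g_kernel d u v = g_kernel d v u"
  by (simp add: g_kernel_def mult.commute)

text \<open>A permutation moves second components only. Swapping them within a pair negates the
  corresponding difference of one-hot vectors and leaves the factor of the first components
  alone.\<close>

lemma h_quad_transpose_inside:
  assumes "distinct [i1, i2, i3, i4]" "(i, j) \<in> {(i1, i4), (i2, i3)}"
  shows "h_quad d1 d2 (permute_sample (Transposition.transpose i j) x) (i1, i2, i3, i4) = - h_quad d1 d2 x (i1, i2, i3, i4)"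
proof -
  have "i = i1 \<and> j = i4 \<or> i = i2 \<and> j = i3" using assms(2) by auto
  then show ?thesis
  proof
    assume "i = i1 \<and> j = i4"
    then show ?thesis using assms(1)
      by (simp add: h_quad_def h_in_def permute_sample_def Transposition.transpose_def
          g_kernel_commute[of d2 "snd (x i4)" "snd (x i2)"] g_kernel_commute[of d2 "snd (x i3)" "snd (x i1)"]
          g_kernel_commute[of d2 "snd (x i4)" "snd (x i3)"] g_kernel_commute[of d2 "snd (x i2)" "snd (x i1)"])
         (simp add: algebra_simps)
  next
    assume "i = i2 \<and> j = i3"
    then show ?thesis using assms(1)
      by (simp add: h_quad_def h_in_def permute_sample_def Transposition.transpose_def) (simp add: algebra_simps)
  qed
qed

lemma h_quad_transpose_outside:
  assumes "{i, j} \<inter> entries J = {}"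
  shows "h_quad d1 d2 (permute_sample (Transposition.transpose i j) x) J = h_quad d1 d2 x J"
  using assms by (cases J) (simp add: h_quad_def permute_sample_def entries_def Transposition.transpose_def)

text \<open>If the quadruples share at most one index, some pair of I avoids J. Transposing this pair is an
  involution on permutations that flips the sign of the first factor and fixes the second.\<close>

lemma sum_perms_h_quad_eq_0:
  assumes "I \<in> quads n" "J \<in> quads n" "\<not> meet_twice I J"
  shows "(\<Sum>\<pi> | \<pi> permutes {1..n}. h_quad d1 d2 (permute_sample \<pi> x) I * h_quad d1 d2 (permute_sample \<pi> x) J) = 0"
    (is "?S = 0")
proof -
  obtain i1 i2 i3 i4 where I: "I = (i1, i2, i3, i4)" by (cases I)
  have d: "distinct [i1, i2, i3, i4]" "{i1, i2, i3, i4} \<subseteq> {1..n}" using assms(1) by (auto simp: I quads_def)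
  obtain i j where ij: "(i, j) \<in> {(i1, i4), (i2, i3)}" "{i, j} \<inter> entries J = {}"
    using not_meet_twice_avoid[OF assms(3)[unfolded I] d(1)] by auto
  have "Transposition.transpose i j permutes {1..n}"
    using ij(1) d(2) by (intro permutes_swap_id) auto
  then have "?S = (\<Sum>\<pi> | \<pi> permutes {1..n}. h_quad d1 d2 (permute_sample (\<pi> \<circ> Transposition.transpose i j) x) I
      * h_quad d1 d2 (permute_sample (\<pi> \<circ> Transposition.transpose i j) x) J)"
    by (rule sum_permutations_compose_right)
  also have "\<dots> = - ?S"
    unfolding permute_sample_comp[symmetric] h_quad_transpose_outside[OF ij(2)] I
      h_quad_transpose_inside[OF d(1) ij(1)] sum_negf[symmetric] by simp
  finally show ?thesis by simp
qed

section \<open>Error bounds for the test\<close>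

context multinomial_sample
begin

text \<open>Averaging over permutations cancels all products of kernels with at most one common
  index, so the bound is free of \<open>del\<close>. The constant 24576 = 256 * 96 comes from the
  remaining pairs.\<close>

lemma E_permuted_U_sq:
  assumes n: "n \<ge> 4"
  shows "E (\<lambda>x. (\<Sum>\<pi> | \<pi> permutes {1..n}. (U_stat d1 d2 n (permute_sample \<pi> x))\<^sup>2) / fact n)
     \<le> 24576 * b * (real n)\<^sup>2 / real (card (quads n))"
proof -
  define N where "N = real (card (quads n))"
  let ?P = "{\<pi>. \<pi> permutes {1..n}}"
  let ?hh = "\<lambda>x I J \<pi>. h (permute_sample \<pi> x) I * h (permute_sample \<pi> x) J"
  have U: "(U_stat d1 d2 n y)\<^sup>2 = 1 / N\<^sup>2 * (\<Sum>I\<in>quads n. \<Sum>J\<in>quads n. h y I * h y J)" for y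
    by (simp add: U_stat_eq[OF n] N_def power_divide sum_product power2_eq_square)
  have "(\<Sum>\<pi>\<in>?P. (U_stat d1 d2 n (permute_sample \<pi> x))\<^sup>2) / fact n
     = 1 / (fact n * N\<^sup>2) * (\<Sum>I\<in>quads n. \<Sum>J\<in>quads n. \<Sum>\<pi>\<in>?P. ?hh x I J \<pi>)" for x
  proof -
    have "(\<Sum>\<pi>\<in>?P. \<Sum>I\<in>quads n. \<Sum>J\<in>quads n. ?hh x I J \<pi>) = (\<Sum>I\<in>quads n. \<Sum>J\<in>quads n. \<Sum>\<pi>\<in>?P. ?hh x I J \<pi>)"
      by (subst sum.swap, subst (2) sum.swap) (rule refl)
    then show ?thesis
      unfolding U sum_distrib_left[symmetric] by simp
  qed
  then have "E (\<lambda>x. (\<Sum>\<pi>\<in>?P. (U_stat d1 d2 n (permute_sample \<pi> x))\<^sup>2) / fact n)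
     = 1 / (fact n * N\<^sup>2) * (\<Sum>I\<in>quads n. \<Sum>J\<in>quads n. E (\<lambda>x. \<Sum>\<pi>\<in>?P. ?hh x I J \<pi>))"
    by (simp only: E_cmult E_sum)
  also have "\<dots> \<le> 1 / (fact n * N\<^sup>2) * (\<Sum>I\<in>quads n. fact n * (24576 * b * (real n)\<^sup>2))"
  proof (intro mult_left_mono sum_mono)
    fix I assume I: "I \<in> quads n"
    have "(\<Sum>J\<in>quads n. E (\<lambda>x. \<Sum>\<pi>\<in>?P. ?hh x I J \<pi>))
       \<le> (\<Sum>J\<in>quads n. fact n * (256 * b) * of_bool (meet_twice I J))"
    proof (rule sum_mono)
      fix J assume J: "J \<in> quads n"
      show "E (\<lambda>x. \<Sum>\<pi>\<in>?P. ?hh x I J \<pi>) \<le> fact n * (256 * b) * of_bool (meet_twice I J)"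
      proof (cases "meet_twice I J")
        case True
        have "E (\<lambda>x. \<Sum>\<pi>\<in>?P. ?hh x I J \<pi>) = (\<Sum>\<pi>\<in>?P. E (\<lambda>x. ?hh x I J \<pi>))"
          by (rule E_sum)
        also have "\<dots> \<le> (\<Sum>\<pi>\<in>?P. 256 * b)"
          by (intro sum_mono E_hh_le I J) simp
        finally show ?thesis using True by (simp add: card_perms[simplified])
      next
        case False
        \<comment> \<open>The cancellation holds for each fixed sample, before taking
          expectations.\<close>
        have "E (\<lambda>x. \<Sum>\<pi>\<in>?P. ?hh x I J \<pi>) = E (\<lambda>_. 0)"
          by (rule arg_cong[of _ _ E], rule ext, rule sum_perms_h_quad_eq_0[OF I J False])
        then show ?thesis using False by simp
      qed
    qed
    also have "\<dots> = fact n * (256 * b) * real (card {J \<in> quads n. meet_twice I J})"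
      unfolding sum_distrib_left[symmetric] by (simp only: sum_of_bool_card finite_quads)
    also have "\<dots> \<le> fact n * (256 * b) * real (96 * n\<^sup>2)"
      using card_meet_twice[OF I] b_pos by (intro mult_left_mono) (simp_all only: of_nat_le_iff, auto)
    finally show "(\<Sum>J\<in>quads n. E (\<lambda>x. \<Sum>\<pi>\<in>?P. ?hh x I J \<pi>)) \<le> fact n * (24576 * b * (real n)\<^sup>2)"
      by simp
  qed simp
  also have "\<dots> = 24576 * b * (real n)\<^sup>2 / N"
    by (simp add: N_def power2_eq_square)
  finally show ?thesis by (simp add: N_def)
qed

text \<open>In terms of \<open>r\<close>, both moment bounds are quadratic in \<open>r\<close> and
  \<open>del\<close> once the fourth power of \<open>n\<close> cancels against the number of
  quadruples; inserting \<open>r \<le> del * w\<close> then cancels \<open>del\<close>.\<close>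

lemma type_II:
  assumes n: "n \<ge> 4" and \<alpha>: "0 < \<alpha>" "\<alpha> < 1" and \<beta>: "0 < \<beta>" "\<beta> < 1" and del: "del > 0"
    and sep: "sqrt b / real n \<le> del * (sqrt \<alpha> * \<beta> / 10000)"
  shows "measure (measure_pmf (sample_law n p)) {x. U_stat d1 d2 n x \<le> crit_value d1 d2 n \<alpha> x} \<le> \<beta>"
proof -
  define r where "r = sqrt b / real n"
  \<comment> \<open>The permutation term needs \<open>w\<^sup>2 / \<alpha>\<close>, and the linear
    variance term \<open>w\<close> itself, to be small against \<open>\<beta>\<close>; the product
    of \<open>sqrt \<alpha>\<close> and \<open>\<beta>\<close> serves both.\<close>
  define w where "w = sqrt \<alpha> * \<beta> / 10000"
  define V where "V = E (\<lambda>x. (U_stat d1 d2 n x - 4 * del)\<^sup>2)"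
  define Q where "Q = E (\<lambda>x. (\<Sum>\<pi> | \<pi> permutes {1..n}. (U_stat d1 d2 n (permute_sample \<pi> x))\<^sup>2) / fact n)"
  have n0: "real n > 0" using n by simp
  have N: "3 / 32 * real n ^ 4 \<le> real (card (quads n))" by (rule card_quads_ge[OF n])
  have N0: "0 < real (card (quads n))" using N n0 by (intro less_le_trans[OF _ N]) simp
  have b: "b = (sqrt b)\<^sup>2" using b_pos by simp
  have r0: "r \<ge> 0" and w0: "w > 0" using b_pos \<alpha> \<beta> by (auto simp: r_def w_def)
  have rw: "r \<le> del * w" using sep by (simp add: r_def w_def)
  have sb: "sqrt b = r * real n" using n0 by (simp add: r_def)
  have quot: "z * real n ^ 4 / real (card (quads n)) \<le> 32 / 3 * z" if "z \<ge> 0" for z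
  proof -
    have "z * real n ^ 4 / real (card (quads n)) \<le> z * real n ^ 4 / (3 / 32 * real n ^ 4)"
      using N N0 n0 that by (intro divide_left_mono mult_nonneg_nonneg mult_pos_pos) simp_all
    then show ?thesis using n0 by simp
  qed
  have "V \<le> (1024 * (sqrt b * del) * real n ^ 3 + 24576 * b * (real n)\<^sup>2) / real (card (quads n))"
    unfolding V_def by (rule U_variance[OF n])
  also have "1024 * (sqrt b * del) * real n ^ 3 + 24576 * b * (real n)\<^sup>2 = (1024 * r * del + 24576 * r\<^sup>2) * real n ^ 4"
    by (subst b, unfold sb) (simp add: power2_eq_square power3_eq_cube power4_eq_xxxx algebra_simps)
  also have "\<dots> / real (card (quads n)) \<le> 32 / 3 * (1024 * r * del + 24576 * r\<^sup>2)"
    using r0 del by (intro quot) simp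
  also have "\<dots> \<le> 32 / 3 * (1024 * (del * w) * del + 24576 * (del * w)\<^sup>2)"
    using r0 rw del by (intro mult_left_mono add_mono mult_right_mono power_mono) auto
  also have "\<dots> = 32 / 3 * (1024 * w + 24576 * w\<^sup>2) * del\<^sup>2"
    by (simp add: power2_eq_square algebra_simps)
  finally have V: "V / (4 * del\<^sup>2) \<le> 8 / 3 * (1024 * w + 24576 * w\<^sup>2)"
    using del by (simp add: field_simps)
  have "Q \<le> 24576 * b * (real n)\<^sup>2 / real (card (quads n))"
    unfolding Q_def by (rule E_permuted_U_sq[OF n])
  also have "24576 * b * (real n)\<^sup>2 = (24576 * r\<^sup>2) * real n ^ 4"
    by (subst b, unfold sb) (simp add: power2_eq_square power3_eq_cube power4_eq_xxxx algebra_simps)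
  also have "\<dots> / real (card (quads n)) \<le> 32 / 3 * (24576 * r\<^sup>2)"
    by (intro quot) simp
  also have "\<dots> \<le> 32 / 3 * (24576 * (del * w)\<^sup>2)"
    using r0 rw del by (intro mult_left_mono power_mono) auto
  also have "\<dots> = 32 / 3 * (24576 * w\<^sup>2) * del\<^sup>2"
    by (simp add: power2_eq_square algebra_simps)
  finally have Q: "Q / (4 * \<alpha> * del\<^sup>2) \<le> 8 / 3 * (24576 * (w\<^sup>2 / \<alpha>))"
    using del \<alpha> by (simp add: field_simps)
  have w_le: "w \<le> \<beta> / 10000"
    using \<alpha> \<beta> by (simp add: w_def mult_left_le_one_le)
  have "\<beta>\<^sup>2 \<le> \<beta>" using \<beta> by (simp add: power2_eq_square)
  then have wa: "w\<^sup>2 / \<alpha> \<le> \<beta> / 100000000"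
    using \<alpha> by (simp add: w_def power_divide power_mult_distrib)
  have "w\<^sup>2 \<le> w\<^sup>2 / \<alpha>" using \<alpha> by (simp add: field_simps mult_left_le_one_le)
  then have w2: "w\<^sup>2 \<le> \<beta> / 100000000" using wa by linarith
  have "measure (measure_pmf (sample_law n p)) {x. U_stat d1 d2 n x \<le> crit_value d1 d2 n \<alpha> x}
     = E (\<lambda>x. of_bool (U_stat d1 d2 n x \<le> crit_value d1 d2 n \<alpha> x))"
    by (rule prob_eq_E)
  also have "\<dots> \<le> E (\<lambda>x. 1 / (4 * del\<^sup>2) * (U_stat d1 d2 n x - 4 * del)\<^sup>2 + 1 / (4 * \<alpha> * del\<^sup>2) *
      ((\<Sum>\<pi> | \<pi> permutes {1..n}. (U_stat d1 d2 n (permute_sample \<pi> x))\<^sup>2) / fact n))"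
    by (rule E_mono) (rule type_II_pointwise[OF \<alpha> del])
  also have "\<dots> = V / (4 * del\<^sup>2) + Q / (4 * \<alpha> * del\<^sup>2)"
    unfolding E_add E_cmult V_def Q_def by simp
  \<comment> \<open>The coefficient of \<open>\<beta>\<close>, 8/3 * 1024 / 10^4 plus twice 8/3 *
    24576 / 10^8, is below 0.28.\<close>
  also have "\<dots> \<le> \<beta>"
    using V Q w_le w2 wa \<beta> by (simp add: algebra_simps)
  finally show ?thesis .
qed

text \<open>Under the null hypothesis the two components are independent, so permuting the second ones
  preserves the law of the sample.\<close>

lemma E_permute_null:
  assumes null: "p = prod_marginals p" and \<sigma>: "\<sigma> permutes {1..n}"
  shows "E (\<lambda>x. F (permute_sample \<sigma> x)) = E F"
proof -
  have p: "pmf p v = pY (fst v) * pZ (snd v)" for v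
  proof -
    have "pmf p v = pmf (prod_marginals p) v" using null by simp
    then show ?thesis by (cases v) (simp add: prod_marginals_def pmf_pair)
  qed
  have inv: "permute_sample \<sigma> (permute_sample (inv \<sigma>) x) = x" "permute_sample (inv \<sigma>) (permute_sample \<sigma> x) = x" for x
    using permutes_inv_o[OF \<sigma>] by (simp_all add: permute_sample_comp permute_sample_id[unfolded id_def] id_def)
  have "map_pmf (permute_sample \<sigma>) (sample_law n p) = sample_law n p"
  proof (rule pmf_eqI)
    fix y
    define x where "x = permute_sample (inv \<sigma>) y"
    have y: "y = permute_sample \<sigma> x" by (simp add: x_def inv)
    \<comment> \<open>Indices outside the sample are fixed by \<open>\<sigma>\<close>, so the dummy
      value \<open>undefined\<close> stays in place and the product law charges both samples
      alike.\<close>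
    have out: "permute_sample \<sigma> x i = x i" if "i \<notin> {1..n}" for i
      using permutes_not_in[OF \<sigma> that] by (simp add: permute_sample_def)
    have out_iff: "(\<forall>i. i \<notin> {1..n} \<longrightarrow> permute_sample \<sigma> x i = undefined) \<longleftrightarrow>
        (\<forall>i. i \<notin> {1..n} \<longrightarrow> x i = undefined)"
      by (metis out)
    \<comment> \<open>Under the null the likelihood splits by components, and reindexing by
      \<open>\<sigma>\<close> leaves the second product unchanged.\<close>
    have "(\<Prod>i\<in>{1..n}. pmf p (permute_sample \<sigma> x i)) = (\<Prod>i\<in>{1..n}. pY (fst (x i))) * (\<Prod>i\<in>{1..n}. pZ (snd (x (\<sigma> i))))"
      by (simp add: p permute_sample_def prod.distrib)
    also have "(\<Prod>i\<in>{1..n}. pZ (snd (x (\<sigma> i)))) = (\<Prod>i\<in>{1..n}. pZ (snd (x i)))"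
      using prod.permute[OF \<sigma>, of "\<lambda>i. pZ (snd (x i))"] by (simp add: o_def)
    also have "(\<Prod>i\<in>{1..n}. pY (fst (x i))) * \<dots> = (\<Prod>i\<in>{1..n}. pmf p (x i))"
      by (simp add: p prod.distrib)
    finally have "pmf (sample_law n p) (permute_sample \<sigma> x) = pmf (sample_law n p) x"
      unfolding sample_law_def pmf_Pi[OF finite_atLeastAtMost] out_iff by (simp only:)
    moreover have "inj (permute_sample \<sigma>)" by (rule inj_on_inverseI[of _ "permute_sample (inv \<sigma>)"]) (simp add: inv)
    ultimately show "pmf (map_pmf (permute_sample \<sigma>) (sample_law n p)) y = pmf (sample_law n p) y"
      unfolding y by (subst pmf_map_inj') auto
  qed
  then show ?thesis
    unfolding E_def by (metis integral_map_pmf)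
qed

text \<open>By invariance, the rejection probability equals its average over all permuted samples.
  These share one critical value, so for each sample the average is the fraction of permuted
  statistics above it.\<close>

lemma type_I:
  assumes null: "p = prod_marginals p" and \<alpha>: "0 < \<alpha>" "\<alpha> < 1"
  shows "measure (measure_pmf (sample_law n p)) {x. U_stat d1 d2 n x > crit_value d1 d2 n \<alpha> x} \<le> \<alpha>"
proof -
  let ?P = "{\<pi>. \<pi> permutes {1..n}}"
  define F where "F x = (of_bool (U_stat d1 d2 n x > crit_value d1 d2 n \<alpha> x) :: real)" for x
  have "E F = 1 / fact n * (\<Sum>\<pi>\<in>?P. E F)"
    by (simp add: card_perms[simplified])
  also have "\<dots> = 1 / fact n * (\<Sum>\<pi>\<in>?P. E (\<lambda>x. F (permute_sample \<pi> x)))"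
    by (simp add: E_permute_null[OF null])
  also have "\<dots> = 1 / fact n * E (\<lambda>x. \<Sum>\<pi>\<in>?P. F (permute_sample \<pi> x))"
    by (simp only: E_sum)
  also have "\<dots> \<le> 1 / fact n * E (\<lambda>x. \<alpha> * fact n)"
  proof (intro mult_left_mono E_mono)
    fix x
    have "(\<Sum>\<pi>\<in>?P. F (permute_sample \<pi> x)) =
        (\<Sum>\<pi>\<in>?P. of_bool (U_stat d1 d2 n (permute_sample \<pi> x) > crit_value d1 d2 n \<alpha> x))"
      by (intro sum.cong) (simp_all add: F_def crit_value_permute)
    then show "(\<Sum>\<pi>\<in>?P. F (permute_sample \<pi> x)) \<le> \<alpha> * fact n"
      using permuted_exceed_crit_value[OF \<alpha>] by simp
  qed simp
  finally show ?thesis by (simp add: prob_eq_E F_def[abs_def])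
qed

lemma del_eq_l2norm: "del = (l2norm d1 d2 (\<lambda>x. pmf p x - pmf (prod_marginals p) x))\<^sup>2"
proof -
  have "pmf (prod_marginals p) u = q u" for u
    by (cases u) (simp add: prod_marginals_def pmf_pair q_def)
  then show ?thesis
    by (simp add: l2norm_def L2_set_def sum_nonneg del_def G_def D_def q_def)
qed

end

section \<open>From the separation condition to the theorem\<close>

lemma powr_quarter_sq: "x \<ge> 0 \<Longrightarrow> (x powr (1/4))\<^sup>2 = sqrt x" for x :: real
  by (simp add: power2_eq_square powr_add[symmetric] powr_half_sqrt)

text \<open>Squaring removes the fractional powers and turns the constant 100 into the 10000 of
  \<open>type_II\<close>; positivity of \<open>L\<close> supplies \<open>del > 0\<close>
  there.\<close>

lemma separation_sq:
  fixes \<alpha> \<beta> b L :: real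
  assumes pos: "\<alpha> > 0" "\<beta> > 0" "b > 0" "n > 0"
    and L: "L \<ge> 100 / (\<alpha> powr (1/4) * \<beta> powr (1/2)) * (b powr (1/4) / real n powr (1/2))"
  shows "L > 0" and "sqrt b / real n \<le> L\<^sup>2 * (sqrt \<alpha> * \<beta> / 10000)"
proof -
  let ?R = "100 / (\<alpha> powr (1/4) * \<beta> powr (1/2)) * (b powr (1/4) / real n powr (1/2))"
  have R: "?R > 0" using pos by simp
  with L show "L > 0" by linarith
  have "?R\<^sup>2 = 10000 / (sqrt \<alpha> * \<beta>) * (sqrt b / real n)"
    using pos by (simp add: power_mult_distrib power_divide powr_quarter_sq powr_half_sqrt)
  moreover have "?R\<^sup>2 \<le> L\<^sup>2" using R L by (intro power_mono) linarith+
  ultimately have "10000 / (sqrt \<alpha> * \<beta>) * (sqrt b / real n) \<le> L\<^sup>2" by simp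
  then have "10000 / (sqrt \<alpha> * \<beta>) * (sqrt b / real n) * (sqrt \<alpha> * \<beta> / 10000) \<le> L\<^sup>2 * (sqrt \<alpha> * \<beta> / 10000)"
    using pos by (intro mult_right_mono) simp_all
  then show "sqrt b / real n \<le> L\<^sup>2 * (sqrt \<alpha> * \<beta> / 10000)"
    using pos by simp
qed

theorem proposition5p3:
  shows "\<exists>C::real. C > 0 \<and>
    (\<forall>(d1::nat) (d2::nat) (n::nat) (\<alpha>::real) (\<beta>::real) (eps :: real \<Rightarrow> real).
       d1 \<ge> 1 \<and> d2 \<ge> 1 \<and> n \<ge> 4 \<and> 0 < \<alpha> \<and> \<alpha> < 1 \<and> 0 < \<beta> \<and> \<beta> < 1 - \<alpha> \<and>
       (\<forall>p \<in> P_Multi d1 d2.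
          eps (b2 d1 d2 p) \<ge>
            C / (\<alpha> powr (1/4) * \<beta> powr (1/2)) * (b2 d1 d2 p powr (1/4) / real n powr (1/2)))
       \<longrightarrow>
       (SUP p \<in> P_null d1 d2.
          emeasure (measure_pmf (sample_law n p))
            {x. U_stat d1 d2 n x > crit_value d1 d2 n \<alpha> x}) \<le> ennreal \<alpha> \<and>
       (SUP p \<in> P_alt d1 d2 eps.
          emeasure (measure_pmf (sample_law n p))
            {x. U_stat d1 d2 n x \<le> crit_value d1 d2 n \<alpha> x}) \<le> ennreal \<beta>)"
proof (intro exI[of _ 100] conjI allI impI SUP_least)
  fix d1 d2 n :: nat and \<alpha> \<beta> :: real and eps :: "real \<Rightarrow> real" and p
  assume H: "d1 \<ge> 1 \<and> d2 \<ge> 1 \<and> n \<ge> 4 \<and> 0 < \<alpha> \<and> \<alpha> < 1 \<and> 0 < \<beta> \<and> \<beta> < 1 - \<alpha> \<and>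
       (\<forall>p \<in> P_Multi d1 d2. eps (b2 d1 d2 p) \<ge>
          100 / (\<alpha> powr (1/4) * \<beta> powr (1/2)) * (b2 d1 d2 p powr (1/4) / real n powr (1/2)))"
  {
    assume "p \<in> P_null d1 d2"
    then interpret multinomial_sample d1 d2 n p by unfold_locales (simp add: P_null_def)
    have "measure (measure_pmf (sample_law n p)) {x. U_stat d1 d2 n x > crit_value d1 d2 n \<alpha> x} \<le> \<alpha>"
      using \<open>p \<in> P_null d1 d2\<close> H by (intro type_I) (auto simp: P_null_def)
    then show "emeasure (measure_pmf (sample_law n p)) {x. U_stat d1 d2 n x > crit_value d1 d2 n \<alpha> x} \<le> ennreal \<alpha>"
      by (simp add: measure_pmf.emeasure_eq_measure ennreal_leI)
  }
  {
    assume p: "p \<in> P_alt d1 d2 eps"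
    then interpret multinomial_sample d1 d2 n p by unfold_locales (simp add: P_alt_def)
    let ?L = "l2norm d1 d2 (\<lambda>x. pmf p x - pmf (prod_marginals p) x)"
    \<comment> \<open>The bound on \<open>eps\<close> is used at the value \<open>b2 d1 d2 p\<close>
      of this very distribution, which is \<open>b\<close>.\<close>
    have "?L \<ge> 100 / (\<alpha> powr (1/4) * \<beta> powr (1/2)) * (b powr (1/4) / real n powr (1/2))"
      using p H supp unfolding b_def P_alt_def by (auto intro: order.trans)
    then have "?L > 0" "sqrt b / real n \<le> ?L\<^sup>2 * (sqrt \<alpha> * \<beta> / 10000)"
      using separation_sq[of \<alpha> \<beta> b n ?L] H b_pos by auto
    then have "measure (measure_pmf (sample_law n p)) {x. U_stat d1 d2 n x \<le> crit_value d1 d2 n \<alpha> x} \<le> \<beta>"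
      using H by (intro type_II) (auto simp: del_eq_l2norm)
    then show "emeasure (measure_pmf (sample_law n p)) {x. U_stat d1 d2 n x \<le> crit_value d1 d2 n \<alpha> x} \<le> ennreal \<beta>"
      by (simp add: measure_pmf.emeasure_eq_measure ennreal_leI)
  }
qed simp

end
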